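(* One has $\gamma_1>0.96$, where $\gamma_1$ is the level of $1$-concentration on the torus. Moreover, the concentrating idempotents can be chosen with arbitrarily large gaps: there is a constant $c>0.96$ such that for every symmetric measurable set $E\subset\mathbb{T}$ of positive measure and every $N\in\mathbb{N}$ there exists a nonzero idempotent $f\in\mathcal{P}$, with gaps at least $N$ between consecutive frequencies, satisfying $$\int_E |f| \;\geq\; c\int_{\mathbb{T}} |f| .$$
   Context: $\mathbb{T}=\mathbb{R}/\mathbb{Z}$ with Lebesgue measure, $e_h(t)=e^{2\pi i h t}$, $\mathbb{N}=\{0,1,2,\dots\}$. The set of idempotents is $\mathcal{P}=\{\sum_{h\in H} e_h : H\subset \mathbb{N},\ H \text{ finite}\}$; the frequencies of $\sum_{h\in H}e_h$ are the elements of $H$. A set $E\subset\mathbb{T}$ is symmetric if $-E=E$. For $p>0$, the level of $p$-concentration $\gamma_p$ is the supremum of all constants $\gamma\ge 0$ such that for every symmetric measurable set $E\subset\mathbb{T}$ of positive measure there is a nonzero $f\in\mathcal{P}$ with $\int_E|f|^p\ge\gamma\int_{\mathbb{T}}|f|^p$. *)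

theory Defs
  imports "HOL-Analysis.Analysis"
begin

text \<open>
  Functions and sets on the torus \<open>\<real>/\<int>\<close> are represented by their 1-periodic lifts to the reals;
  measure and integral on the torus are taken over the fundamental domain \<open>[0,1)\<close>.
\<close>

definition torus_set :: "real set \<Rightarrow> bool" where
  "torus_set E \<longleftrightarrow> E \<in> sets lebesgue \<and> (\<forall>t. t + 1 \<in> E \<longleftrightarrow> t \<in> E)"

definition torus_measure :: "real set \<Rightarrow> ennreal" where
  "torus_measure E = emeasure lebesgue (E \<inter> {0..<1})"

definition torus_integral :: "real set \<Rightarrow> (real \<Rightarrow> real) \<Rightarrow> real" where
  "torus_integral E g = set_lebesgue_integral lebesgue (E \<inter> {0..<1}) g"

definition symmetric_set :: "real set \<Rightarrow> bool" where
  "symmetric_set E \<longleftrightarrow> uminus ` E = E"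

definition character :: "nat \<Rightarrow> real \<Rightarrow> complex" where
  "character h t = exp (2 * of_real pi * \<i> * of_nat h * of_real t)"

definition idempotent_of :: "nat set \<Rightarrow> real \<Rightarrow> complex" where
  "idempotent_of H = (\<lambda>t. \<Sum>h\<in>H. character h t)"

definition idempotents :: "(real \<Rightarrow> complex) set" where
  "idempotents = {idempotent_of H | H. finite H}"

definition gaps_at_least :: "nat \<Rightarrow> nat set \<Rightarrow> bool" where
  "gaps_at_least N H \<longleftrightarrow>
     (\<forall>h\<in>H. \<forall>k\<in>H. h < k \<and> H \<inter> {h<..<k} = {} \<longrightarrow> h + N \<le> k)"

text \<open>
  For \<open>p > 0\<close> the set below contains 0 and is bounded above by 1 (take \<open>E = UNIV\<close>),
  so the real supremum is the true one.
\<close>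

definition concentration_level :: "real \<Rightarrow> real" where
  "concentration_level p = Sup {\<gamma>. \<gamma> \<ge> 0 \<and>
     (\<forall>E. torus_set E \<and> symmetric_set E \<and> torus_measure E > 0 \<longrightarrow>
        (\<exists>f\<in>idempotents. f \<noteq> (\<lambda>t. 0) \<and>
           torus_integral E (\<lambda>t. cmod (f t) powr p)
             \<ge> \<gamma> * torus_integral UNIV (\<lambda>t. cmod (f t) powr p)))}"

end

theory Submission
  imports Defs
begin

text \<open>
  In fact the \<open>L\<^sup>1\<close> norm of idempotents can be concentrated on \<open>E\<close> to any level \<open>c < 1\<close>
  (\<open>concentration_with_gaps\<close>); the theorem takes \<open>c = 0.97\<close>.

  Write \<open>e(t)\<close> for \<open>exp (2 \<pi> i t)\<close>. The source of flexibility is scale separation: an idempotent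
  \<open>f x = \<Sum> e ((M h + r\<^sub>h) x)\<close> with a huge \<open>M\<close> has large gaps, and near a point \<open>x\<close> it looks, at
  scale \<open>1/M\<close>, like the function \<open>s \<mapsto> \<Sum> e (h s + r\<^sub>h x)\<close>. So \<open>\<bar>f\<bar>\<close> converges weakly to the weight
  \<open>\<integral> \<bar>\<Sum> e (h s + r\<^sub>h x)\<bar> ds\<close>, which varies slowly and may be shaped by the choice of \<open>h\<close> and \<open>r\<^sub>h\<close>.
  Call a continuous weight attainable if it is, up to positive factors, a weak limit of moduli of
  idempotents with arbitrarily large gaps. It then suffices to find an attainable weight with almost
  all its mass on \<open>E\<close>. The test functions of the weak limit are bounded and measurable, so that the
  indicator of \<open>E\<close> is one of them.

  Attainable weights are closed under uniform limits, under products (multiply \<open>f\<close> by an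
  idempotent whose gaps exceed the degree of \<open>f\<close>), and under correlation
  \<open>x \<mapsto> \<integral> v s * w (s + x) ds\<close> (take \<open>f\<^sub>1 (M x) f\<^sub>2 ((M + 1) x)\<close>).

  The starting weight is \<open>\<phi> x = \<integral> \<bar>1 + e s\<bar> \<bar>1 + e (2 s + m x)\<bar> ds\<close>, from the idempotents
  \<open>(1 + e (M x)) (1 + e ((2 M + m) x))\<close>. Its \<open>k\<close>-th Fourier coefficient in the variable \<open>m x\<close> is
  the product of the \<open>k\<close>-th and the \<open>2k\<close>-th coefficient of \<open>\<bar>1 + e\<bar>\<close>; after normalisation it
  is \<open>1 - 2/45 cos (2 \<pi> m x)\<close> plus a remainder orthogonal to these two terms and at most \<open>1/90\<close>
  in absolute value (\<open>wave_base\<close>).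
  Correlating \<open>n\<close> copies raises coefficients to the \<open>n\<close>-th power. This gives
  \<open>1 + 2 (-1/45)\<^sup>n cos (2 \<pi> m x)\<close> with a remainder of at most \<open>(1/90)\<^sup>n\<close>, so the oscillating part is
  small, nearly pure, and of either sign according to the parity of \<open>n\<close>. Powers with exponent about
  \<open>\<bar>t\<bar> 45\<^sup>n / 2\<close> therefore converge to \<open>exp (t cos (2 \<pi> m x))\<close>, for every real \<open>t\<close> and every \<open>m\<close>.
  Products of these are the exponentials of all cosine polynomials, and by the theorem of Weierstrass
  every positive continuous even periodic function is attainable (\<open>attainable_weight\<close>). The symmetry
  of \<open>E\<close> means that its indicator is even, hence a limit of such functions.
\<close>

section \<open>Integration over the circle\<close>

text \<open>
  The measure lives on the whole line but charges only the fundamental domain, so that its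
  measurable functions are exactly the Borel functions on the line.
\<close>

definition circle :: "real measure" where
  "circle = density lborel (\<lambda>x. ennreal (indicator {0..<1} x))"

lemma sets_circle [measurable_cong, simp]: "sets circle = sets borel"
  by (simp add: circle_def)

lemma space_circle [simp]: "space circle = UNIV"
  by (simp add: circle_def)

lemma emeasure_circle_UNIV: "emeasure circle UNIV = 1"
proof -
  have "emeasure circle UNIV = (\<integral>\<^sup>+x. (indicator {0..<1::real} x :: ennreal) \<partial>lborel)"
    unfolding circle_def by (subst emeasure_density) (auto simp: ennreal_indicator)
  also have "\<dots> = 1" by (subst nn_integral_indicator) auto
  finally show ?thesis .
qed

interpretation circle: finite_measure circle
  by standard (simp add: emeasure_circle_UNIV)

interpretation circle2: pair_sigma_finite circle circle ..

lemma measure_circle_UNIV [simp]: "measure circle UNIV = 1"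
  by (simp add: measure_def emeasure_circle_UNIV)

lemma AE_circle_mem: "AE x in circle. x \<in> {0..<1}"
  unfolding circle_def by (subst AE_density) (auto split: split_indicator)

lemma AE_circle_of_lborel: "AE x in lborel. P x \<Longrightarrow> AE x in circle. P x"
  unfolding circle_def by (subst AE_density) auto

lemma integral_circle:
  fixes f :: "real \<Rightarrow> real"
  assumes "f \<in> borel_measurable borel"
  shows "integral\<^sup>L circle f = (\<integral>x. indicator {0..<1} x * f x \<partial>lborel)"
  unfolding circle_def using assms by (subst integral_density) auto

lemma integrable_circle:
  fixes f :: "real \<Rightarrow> real"
  assumes "f \<in> borel_measurable borel" "\<And>x. x \<in> {0..<1} \<Longrightarrow> \<bar>f x\<bar> \<le> B"
  shows "integrable circle f"
proof (rule circle.integrable_const_bound)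
  show "AE x in circle. norm (f x) \<le> B"
    using AE_circle_mem by eventually_elim (use assms in auto)
qed (use assms in simp)

lemma integral_circle_mono:
  fixes f g :: "real \<Rightarrow> real"
  assumes "integrable circle f" "integrable circle g" "\<And>x. x \<in> {0..<1} \<Longrightarrow> f x \<le> g x"
  shows "integral\<^sup>L circle f \<le> integral\<^sup>L circle g"
  using assms(1,2)
proof (rule integral_mono_AE)
  show "AE x in circle. f x \<le> g x"
    using AE_circle_mem by eventually_elim (use assms in auto)
qed

lemma abs_integral_circle_le:
  fixes f :: "real \<Rightarrow> real"
  assumes f: "f \<in> borel_measurable borel" and b: "\<And>x. x \<in> {0..<1} \<Longrightarrow> \<bar>f x\<bar> \<le> B"
  shows "\<bar>integral\<^sup>L circle f\<bar> \<le> B"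
proof -
  have i: "integrable circle f" by (rule integrable_circle [OF f b])
  have "\<bar>integral\<^sup>L circle f\<bar> \<le> (\<integral>x. \<bar>f x\<bar> \<partial>circle)"
    by (rule integral_abs_bound)
  also have "\<dots> \<le> (\<integral>x. B \<partial>circle)"
    using i b by (intro integral_circle_mono) auto
  finally show ?thesis by simp
qed

lemma integral_circle_cong:
  fixes f g :: "real \<Rightarrow> real"
  assumes "f \<in> borel_measurable borel" "g \<in> borel_measurable borel"
    and "\<And>x. x \<in> {0..<1} \<Longrightarrow> f x = g x"
  shows "integral\<^sup>L circle f = integral\<^sup>L circle g"
proof (rule integral_cong_AE)
  show "AE x in circle. f x = g x"
    using AE_circle_mem by eventually_elim (use assms in auto)
qed (use assms in simp_all)

lemma integral_circle_FTC:
  fixes f F :: "real \<Rightarrow> real"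
  assumes "\<And>x. (F has_real_derivative f x) (at x)" "continuous_on UNIV f"
  shows "integral\<^sup>L circle f = F 1 - F 0"
proof -
  have [measurable]: "f \<in> borel_measurable borel"
    using assms(2) by (rule borel_measurable_continuous_onI)
  have "integral\<^sup>L circle f = (\<integral>x. f x * indicator {0..<1} x \<partial>lborel)"
    by (subst integral_circle) (auto simp: mult.commute)
  also have "\<dots> = (\<integral>x. f x * indicator {0..1} x \<partial>lborel)"
  proof (rule integral_cong_AE)
    have "AE x in lborel. x \<noteq> (1::real)" by (rule AE_lborel_singleton)
    then show "AE x in lborel. f x * indicator {0..<1} x = f x * indicator {0..1} x"
      by eventually_elim (auto split: split_indicator)
  qed auto
  also have "\<dots> = F 1 - F 0"
    using assms by (intro integral_FTC_Icc_real) (auto simp: continuous_on_eq_continuous_at)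
  finally show ?thesis .
qed

text \<open>
  Cutting the circle into \<open>M\<close> cells of length \<open>1/M\<close> separates the position inside a cell
  from the number of the cell. Dilation invariance and the averaging of fast oscillations both rest on
  this formula.
\<close>

lemma integral_circle_cells:
  fixes f :: "real \<Rightarrow> real"
  assumes f [measurable]: "f \<in> borel_measurable borel" and b: "\<And>x. x \<in> {0..<1} \<Longrightarrow> \<bar>f x\<bar> \<le> B"
    and M: "M > 0"
  shows "integral\<^sup>L circle f = (\<Sum>k<M. \<integral>s. f ((s + real k) / real M) \<partial>circle) / real M"
proof -
  let ?I = "\<lambda>k. {real k / real M ..< (real k + 1) / real M}"
  \<comment> \<open>The cell of a point is read off from the integer part of \<open>x M\<close>.\<close>
  have ind: "indicat_real {0..<1} x = (\<Sum>k<M. indicator (?I k) x)" for x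
  proof -
    have iff: "x \<in> ?I k \<longleftrightarrow> \<lfloor>x * real M\<rfloor> = int k" for k
      using M by (auto simp: field_simps floor_eq_iff)
    have mem: "x \<in> {0..<1} \<longleftrightarrow> (\<exists>k<M. \<lfloor>x * real M\<rfloor> = int k)"
    proof
      assume x: "x \<in> {0..<1}"
      then have "0 \<le> \<lfloor>x * real M\<rfloor>" "\<lfloor>x * real M\<rfloor> < int M"
        using M by (auto simp: floor_less_iff)
      then show "\<exists>k<M. \<lfloor>x * real M\<rfloor> = int k"
        by (metis nat_less_iff nat_0_le)
    next
      assume "\<exists>k<M. \<lfloor>x * real M\<rfloor> = int k"
      then obtain k where k: "k < M" "\<lfloor>x * real M\<rfloor> = int k" by blast
      have "real k \<le> x * real M" "x * real M < real k + 1"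
        using k(2) by (auto simp: floor_eq_iff)
      moreover have "real k + 1 \<le> real M" using k(1) by linarith
      ultimately have "0 \<le> x * real M" "x * real M < 1 * real M" by linarith+
      then show "x \<in> {0..<1}" using M by (auto simp: zero_le_mult_iff mult_less_cancel_right)
    qed
    show ?thesis
    proof (cases "x \<in> {0..<1}")
      case True
      then obtain k where k: "k < M" "\<lfloor>x * real M\<rfloor> = int k" using mem by blast
      have "(\<Sum>i<M. indicator (?I i) x) = (\<Sum>i<M. if i = k then 1 else 0 :: real)"
        using k by (intro sum.cong refl) (simp only: indicator_def iff, auto)
      then show ?thesis using True k by simp
    next
      case False
      then have "(\<Sum>i<M. indicator (?I i) x) = (0::real)"
        using mem iff by (intro sum.neutral) (auto simp: indicator_def)
      then show ?thesis using False by simp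
    qed
  qed
  have int: "integrable lborel (\<lambda>x. indicator (?I k) x * f x)" if "k < M" for k
  proof -
    have i: "integrable circle f" by (rule integrable_circle [OF f b])
    then have "integrable lborel (\<lambda>x. indicator {0..<1} x * f x)"
      unfolding circle_def by (subst (asm) integrable_density) auto
    then have "integrable lborel (\<lambda>x. indicator (?I k) x *\<^sub>R (indicator {0..<1} x * f x))"
      by (intro integrable_mult_indicator) auto
    moreover have "?I k \<subseteq> {0..<1}"
    proof
      fix x assume x: "x \<in> ?I k"
      have "(real k + 1) / real M \<le> 1"
        using that M by (simp add: divide_simps)
      moreover have "0 \<le> real k / real M" by simp
      ultimately show "x \<in> {0..<1}"
        using x unfolding atLeastLessThan_iff by linarith
    qed
    then have sub: "x \<in> ?I k \<Longrightarrow> x \<in> {0..<1}" for x by blast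
    have "(\<lambda>x. indicator (?I k) x *\<^sub>R (indicator {0..<1} x * f x)) = (\<lambda>x. indicator (?I k) x * f x)"
    proof
      fix x show "indicator (?I k) x *\<^sub>R (indicator {0..<1} x * f x) = indicator (?I k) x * f x"
        using sub [of x] by (cases "x \<in> ?I k") (simp_all only: indicator_simps, simp_all)
    qed
    ultimately show ?thesis by simp
  qed
  have "integral\<^sup>L circle f = (\<integral>x. (\<Sum>k<M. indicator (?I k) x * f x) \<partial>lborel)"
    by (subst integral_circle) (auto simp: ind sum_distrib_right)
  also have "\<dots> = (\<Sum>k<M. \<integral>x. indicator (?I k) x * f x \<partial>lborel)"
    using int by (subst Bochner_Integration.integral_sum) auto
  also have "\<dots> = (\<Sum>k<M. (\<integral>s. f ((s + real k) / real M) \<partial>circle) / real M)"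
  proof (intro sum.cong refl)
    fix k
    have "(\<integral>x. indicator (?I k) x * f x \<partial>lborel) =
        \<bar>1 / real M\<bar> *\<^sub>R (\<integral>x. indicator (?I k) (real k / real M + (1 / real M) * x)
          * f (real k / real M + (1 / real M) * x) \<partial>lborel)"
      using M by (intro lborel_integral_real_affine) auto
    also have "(\<lambda>x. indicator (?I k) (real k / real M + (1 / real M) * x)
          * f (real k / real M + (1 / real M) * x)) =
        (\<lambda>x. indicator {0..<1} x * f ((x + real k) / real M))"
      using M by (auto simp: fun_eq_iff indicator_def field_simps)
    also have "(\<integral>x. indicator {0..<1} x * f ((x + real k) / real M) \<partial>lborel) =
        (\<integral>s. f ((s + real k) / real M) \<partial>circle)"
      by (subst integral_circle) auto
    finally show "(\<integral>x. indicator (?I k) x * f x \<partial>lborel) =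
        (\<integral>s. f ((s + real k) / real M) \<partial>circle) / real M"
      by simp
  qed
  finally show ?thesis by (simp add: sum_divide_distrib)
qed

section \<open>Periodic functions\<close>

definition periodic :: "(real \<Rightarrow> 'a) \<Rightarrow> bool" where
  "periodic f \<longleftrightarrow> (\<forall>x. f (x + 1) = f x)"

lemma periodicD: "periodic f \<Longrightarrow> f (x + 1) = f x"
  unfolding periodic_def by blast

lemma periodicI: "(\<And>x. f (x + 1) = f x) \<Longrightarrow> periodic f"
  unfolding periodic_def by blast

lemma periodic_add_nat: "periodic f \<Longrightarrow> f (x + real k) = f x"
proof (induction k)
  case (Suc k)
  have "f (x + real (Suc k)) = f ((x + real k) + 1)" by (simp add: algebra_simps)
  then show ?case using Suc periodicD by metis
qed simp

lemma periodic_add_int: "periodic f \<Longrightarrow> f (x + of_int k) = f x"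
proof (cases k)
  case (nonneg n)
  assume "periodic f" then show ?thesis using periodic_add_nat [of f x n] nonneg by simp
next
  case (neg n)
  assume "periodic f" then show ?thesis
    using periodic_add_nat [of f "x + of_int k" "Suc n"] neg by simp
qed

lemma periodic_frac: "periodic f \<Longrightarrow> f (frac x) = f x"
  using periodic_add_int [of f "frac x" "\<lfloor>x\<rfloor>"] by (simp add: frac_def)

text \<open>
  These are the test functions of the weak limits below: general enough to contain indicators of
  measurable periodic sets.
\<close>

definition torus_fun :: "(real \<Rightarrow> real) \<Rightarrow> bool" where
  "torus_fun g \<longleftrightarrow> g \<in> borel_measurable borel \<and> (\<exists>B. \<forall>x. \<bar>g x\<bar> \<le> B) \<and> periodic g"

definition torus_cont :: "(real \<Rightarrow> real) \<Rightarrow> bool" where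
  "torus_cont g \<longleftrightarrow> continuous_on UNIV g \<and> periodic g"

lemma torus_fun_measurable: "torus_fun g \<Longrightarrow> g \<in> borel_measurable borel"
  by (simp add: torus_fun_def)

lemma torus_fun_bounded:
  assumes "torus_fun g" obtains B where "\<And>x. \<bar>g x\<bar> \<le> B" "B > 0"
proof -
  obtain B where "\<And>x. \<bar>g x\<bar> \<le> B" using assms by (auto simp: torus_fun_def)
  then have "\<And>x. \<bar>g x\<bar> \<le> max B 1" "max B 1 > 0" by (auto simp: le_max_iff_disj)
  then show ?thesis using that by blast
qed

lemma torus_cont_fun: assumes "torus_cont g" shows "torus_fun g"
proof -
  have "compact (g ` {0..1})"
    using assms by (intro compact_continuous_image) (auto simp: torus_cont_def intro: continuous_on_subset)
  then have "bounded (g ` {0..1})" by (rule compact_imp_bounded)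
  then obtain B where B: "\<And>x. x \<in> {0..1} \<Longrightarrow> \<bar>g x\<bar> \<le> B"
    unfolding bounded_iff real_norm_def by blast
  have "\<bar>g x\<bar> \<le> B" for x
    using B [of "frac x"] periodic_frac [of g x] assms
    by (simp add: torus_cont_def frac_lt_1 less_imp_le)
  then show ?thesis
    using assms by (auto simp: torus_fun_def torus_cont_def intro: borel_measurable_continuous_onI)
qed

lemma torus_fun_integrable: assumes "torus_fun g" shows "integrable circle g"
proof -
  obtain B where "\<And>x. \<bar>g x\<bar> \<le> B" using torus_fun_bounded [OF assms] by blast
  then show ?thesis by (intro integrable_circle torus_fun_measurable assms)
qed

lemma torus_fun_mult: assumes "torus_fun f" "torus_fun g" shows "torus_fun (\<lambda>x. f x * g x)"
proof -
  obtain A where "\<And>x. \<bar>f x\<bar> \<le> A" using assms(1) torus_fun_bounded by blast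
  moreover obtain B where "\<And>x. \<bar>g x\<bar> \<le> B" using assms(2) torus_fun_bounded by blast
  ultimately have "\<bar>f x * g x\<bar> \<le> A * B" for x
    by (simp add: abs_mult mult_mono')
  then have "\<exists>C. \<forall>x. \<bar>f x * g x\<bar> \<le> C" by blast
  moreover have "periodic (\<lambda>x. f x * g x)"
    using assms unfolding torus_fun_def periodic_def by presburger
  moreover have "(\<lambda>x. f x * g x) \<in> borel_measurable borel"
    using assms by (intro borel_measurable_times torus_fun_measurable)
  ultimately show ?thesis by (simp add: torus_fun_def)
qed

lemma torus_fun_compose_affine:
  assumes "torus_fun g" shows "torus_fun (\<lambda>x. g (real n * x + t))"
proof -
  have "g (real n * (x + 1) + t) = g (real n * x + t)" for x
  proof -
    have per: "periodic g" using assms unfolding torus_fun_def by blast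
    have eq: "real n * (x + 1) + t = (real n * x + t) + real n" by (simp add: algebra_simps)
    show ?thesis unfolding eq by (rule periodic_add_nat [OF per])
  qed
  then have "\<forall>x. g (real n * (x + 1) + t) = g (real n * x + t)" by blast
  then have "periodic (\<lambda>x. g (real n * x + t))" unfolding periodic_def .
  moreover have "(\<lambda>x. g (real n * x + t)) \<in> borel_measurable borel"
    by (rule measurable_compose [OF _ torus_fun_measurable [OF assms]]) measurable
  moreover have "\<exists>B. \<forall>x. \<bar>g (real n * x + t)\<bar> \<le> B"
  proof -
    from torus_fun_bounded [OF assms] obtain B where B: "\<And>x. \<bar>g x\<bar> \<le> B" by blast
    show ?thesis by (rule exI [of _ B], rule allI, rule B)
  qed
  ultimately show ?thesis unfolding torus_fun_def by (intro conjI)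
qed

lemma torus_cont_compose_affine:
  assumes "torus_cont g" shows "torus_cont (\<lambda>x. g (real n * x + t))"
proof -
  have "g (real n * (x + 1) + t) = g (real n * x + t)" for x
  proof -
    have per: "periodic g" using assms unfolding torus_cont_def by blast
    have eq: "real n * (x + 1) + t = (real n * x + t) + real n" by (simp add: algebra_simps)
    show ?thesis unfolding eq by (rule periodic_add_nat [OF per])
  qed
  then have "\<forall>x. g (real n * (x + 1) + t) = g (real n * x + t)" by blast
  then have "periodic (\<lambda>x. g (real n * x + t))" unfolding periodic_def .
  moreover have "continuous_on UNIV (\<lambda>x. g (real n * x + t))"
  proof (rule continuous_on_compose2 [of UNIV g UNIV "\<lambda>x. real n * x + t"])
    show "continuous_on UNIV g" using assms by (simp add: torus_cont_def)
    show "continuous_on UNIV (\<lambda>x. real n * x + t)" by (intro continuous_intros)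
  qed simp
  ultimately show ?thesis unfolding torus_cont_def by (rule conjI [rotated])
qed

lemma torus_cont_mult: "torus_cont f \<Longrightarrow> torus_cont g \<Longrightarrow> torus_cont (\<lambda>x. f x * g x)"
  unfolding torus_cont_def periodic_def by (metis continuous_on_mult)

lemma torus_cont_add: "torus_cont f \<Longrightarrow> torus_cont g \<Longrightarrow> torus_cont (\<lambda>x. f x + g x)"
  unfolding torus_cont_def periodic_def by (metis continuous_on_add)

lemma torus_cont_const: "torus_cont (\<lambda>x. c)"
  by (auto simp: torus_cont_def intro: periodicI)

lemma torus_fun_cmult: "torus_fun f \<Longrightarrow> torus_fun (\<lambda>x. c * f x)"
  using torus_fun_mult [OF torus_cont_fun [OF torus_cont_const [of c]]] by simp

lemma integral_circle_dilate:
  assumes g: "torus_fun g" and M: "M > 0"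
  shows "(\<integral>x. g (real M * x) \<partial>circle) = integral\<^sup>L circle g"
proof -
  have [measurable]: "g \<in> borel_measurable borel" using g by (rule torus_fun_measurable)
  obtain B where B: "\<And>x. \<bar>g x\<bar> \<le> B" using g torus_fun_bounded by blast
  have "(\<integral>x. g (real M * x) \<partial>circle) = (\<Sum>k<M. \<integral>s. g (real M * ((s + real k) / real M)) \<partial>circle) / real M"
    by (rule integral_circle_cells [where B = B]) (use B M in auto)
  also have "\<dots> = (\<Sum>k<M. integral\<^sup>L circle g) / real M"
    using M g by (simp add: periodic_add_nat torus_fun_def)
  finally show ?thesis using M by simp
qed

lemma integral_circle_shift:
  assumes g: "torus_fun g"
  shows "(\<integral>x. g (x + t) \<partial>circle) = integral\<^sup>L circle g"
proof -
  have [measurable]: "g \<in> borel_measurable borel" using g by (rule torus_fun_measurable)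
  have per: "periodic g" using g by (simp add: torus_fun_def)
  obtain B where B: "\<And>x. \<bar>g x\<bar> \<le> B" using g torus_fun_bounded by blast
  define u where "u = frac t"
  have u: "0 \<le> u" "u < 1" by (auto simp: u_def frac_lt_1)
  have gt: "g (x + t) = g (x + u)" for x
    using periodic_add_int [OF per, of "x + u" "\<lfloor>t\<rfloor>"] by (simp add: u_def frac_def algebra_simps)
  have int: "integrable lborel (\<lambda>x. indicator {a..<b} x * g x)" for a b
  proof (rule Bochner_Integration.integrable_bound)
    show "integrable lborel (\<lambda>x. indicator {a..<b} x * B)"
      by (intro integrable_mult_left integrable_real_indicator) (auto intro!: emeasure_bounded_finite [unfolded infinity_ennreal_def])
    show "AE x in lborel. norm (indicator {a..<b} x * g x) \<le> norm (indicator {a..<b} x * B)"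
    proof (rule AE_I2)
      fix x
      have "\<bar>g x\<bar> \<le> \<bar>B\<bar>" using B [of x] by linarith
      then show "norm (indicator {a..<b} x * g x) \<le> norm (indicator {a..<b} x * B)"
        by (simp add: indicator_def)
    qed
  qed auto
  have "(\<integral>x. g (x + t) \<partial>circle) = (\<integral>x. indicator {0..<1} x * g (x + u) \<partial>lborel)"
    unfolding gt by (rule integral_circle) simp
  also have "\<dots> = (\<integral>x. indicator {u..<1 + u} x * g x \<partial>lborel)"
  proof -
    have "(\<integral>x. indicator {u..<1 + u} x * g x \<partial>lborel) =
        \<bar>1\<bar> *\<^sub>R (\<integral>x. indicator {u..<1 + u} (u + 1 * x) * g (u + 1 * x) \<partial>lborel)"
      by (rule lborel_integral_real_affine) simp
    also have "(\<lambda>x. indicator {u..<1+u} (u + 1 * x) * g (u + 1 * x)) = (\<lambda>x. indicator {0..<1} x * g (x + u))"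
      by (intro ext arg_cong2 [where f = "(*)"]) (simp_all add: indicator_def add.commute)
    finally show ?thesis by simp
  qed
  also have "\<dots> = (\<integral>x. indicator {u..<1} x * g x + indicator {1..<1+u} x * g x \<partial>lborel)"
    using u by (intro Bochner_Integration.integral_cong refl) (simp add: indicator_def)
  also have "\<dots> = (\<integral>x. indicator {u..<1} x * g x \<partial>lborel) + (\<integral>x. indicator {1..<1+u} x * g x \<partial>lborel)"
    by (intro Bochner_Integration.integral_add int)
  also have "(\<integral>x. indicator {1..<1+u} x * g x \<partial>lborel) = (\<integral>x. indicator {0..<u} x * g x \<partial>lborel)"
  proof -
    have "(\<integral>x. indicator {1..<1+u} x * g x \<partial>lborel) =
        \<bar>1\<bar> *\<^sub>R (\<integral>x. indicator {1..<1+u} (1 + 1 * x) * g (1 + 1 * x) \<partial>lborel)"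
      by (rule lborel_integral_real_affine) simp
    also have "(\<lambda>x. indicator {1..<1+u} (1 + 1 * x) * g (1 + 1 * x)) = (\<lambda>x. indicator {0..<u} x * g x)"
    proof
      fix x
      have "g (1 + 1 * x) = g x" using periodicD [OF per, of x] by (simp add: add.commute)
      then show "indicator {1..<1+u} (1 + 1 * x) * g (1 + 1 * x) = indicator {0..<u} x * g x"
        by (simp add: indicator_def)
    qed
    finally show ?thesis by simp
  qed
  also have "(\<integral>x. indicator {u..<1} x * g x \<partial>lborel) + (\<integral>x. indicator {0..<u} x * g x \<partial>lborel) =
      (\<integral>x. indicator {u..<1} x * g x + indicator {0..<u} x * g x \<partial>lborel)"
    by (intro Bochner_Integration.integral_add [symmetric] int)
  also have "\<dots> = (\<integral>x. indicator {0..<1} x * g x \<partial>lborel)"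
    by (intro Bochner_Integration.integral_cong refl) (use u in \<open>auto simp: indicator_def\<close>)
  also have "\<dots> = integral\<^sup>L circle g" by (subst integral_circle) auto
  finally show ?thesis .
qed

section \<open>Averaging of fast oscillations\<close>

lemma uniform_cont_strip:
  fixes F :: "real \<Rightarrow> real \<Rightarrow> real"
  assumes cont: "continuous_on UNIV (\<lambda>(s,x). F s x)" and e: "e > 0"
  obtains d where "d > 0" "\<And>s x y. \<lbrakk>s \<in> {0..1}; x \<in> {0..1}; y \<in> {0..1}; \<bar>x - y\<bar> < d\<rbrakk> \<Longrightarrow> \<bar>F s x - F s y\<bar> < e"
proof -
  have "uniformly_continuous_on ({0..1} \<times> {0..1}) (\<lambda>(s,x). F s x)"
    using cont by (intro compact_uniformly_continuous compact_Times) (auto intro: continuous_on_subset)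
  then obtain d where d: "d > 0" and
    *: "\<And>p q. \<lbrakk>p \<in> {0..1} \<times> {0..1}; q \<in> {0..1} \<times> {0..1}; dist q p < d\<rbrakk>
        \<Longrightarrow> dist (case q of (s,x) \<Rightarrow> F s x) (case p of (s,x) \<Rightarrow> F s x) < e"
    using e unfolding uniformly_continuous_on_def by metis
  show ?thesis
  proof (rule that [OF d])
    fix s x y :: real
    assume "s \<in> {0..1}" "x \<in> {0..1}" "y \<in> {0..1}" "\<bar>x - y\<bar> < d"
    then show "\<bar>F s x - F s y\<bar> < e"
      using * [of "(s,y)" "(s,x)"] by (simp add: dist_Pair_Pair dist_real_def)
  qed
qed

lemma measurable_of_continuous_pair:
  fixes F :: "real \<Rightarrow> real \<Rightarrow> real"
  assumes "continuous_on UNIV (\<lambda>(s,x). F s x)"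
  shows "(\<lambda>(s,x). F s x) \<in> borel_measurable (borel \<Otimes>\<^sub>M borel)"
  using borel_measurable_continuous_onI [OF assms] by (simp add: borel_prod)

text \<open>
  In the cell with number \<open>k\<close> the second argument of \<open>F (M x) x\<close> is nearly constant while the first one
  runs through a full period, so the integral over the cell is nearly that of the average of \<open>F\<close>.
  Uniform continuity bounds the error of all cells at once.
\<close>

lemma oscillation_limit_continuous:
  fixes F :: "real \<Rightarrow> real \<Rightarrow> real"
  assumes cont: "continuous_on UNIV (\<lambda>(s,x). F s x)" and per: "\<And>s k. F (s + real k) = F s"
  shows "(\<lambda>M. \<integral>x. F (real M * x) x \<partial>circle) \<longlonglongrightarrow> (\<integral>x. (\<integral>s. F s x \<partial>circle) \<partial>circle)"
proof (rule LIMSEQ_I)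
  fix e :: real assume e: "e > 0"
  obtain d where d: "d > 0"
    and unif: "\<And>s x y. \<lbrakk>s \<in> {0..1}; x \<in> {0..1}; y \<in> {0..1}; \<bar>x - y\<bar> < d\<rbrakk> \<Longrightarrow> \<bar>F s x - F s y\<bar> < e / 2"
    using uniform_cont_strip [OF cont, of "e / 2"] e by auto
  have pm [measurable]: "(\<lambda>(s,x). F s x) \<in> borel_measurable (borel \<Otimes>\<^sub>M borel)"
    by (rule measurable_of_continuous_pair [OF cont])
  have meas [measurable]: "(\<lambda>x. F (u x) (v x)) \<in> borel_measurable borel"
    if [measurable]: "u \<in> borel_measurable borel" "v \<in> borel_measurable borel" for u v
    using measurable_compose [OF measurable_Pair [OF that] pm] by simp
  have "compact ((\<lambda>(s,x). F s x) ` ({0..1} \<times> {0..1}))"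
    using cont by (intro compact_continuous_image compact_Times) (auto intro: continuous_on_subset)
  then have "bounded ((\<lambda>(s,x). F s x) ` ({0..1} \<times> {0..1}))" by (rule compact_imp_bounded)
  then obtain B where B: "\<And>s x. \<lbrakk>s \<in> {0..1}; x \<in> {0..1}\<rbrakk> \<Longrightarrow> \<bar>F s x\<bar> \<le> B"
    unfolding bounded_iff real_norm_def by fast
  have Fb: "\<bar>F (real M * x) x\<bar> \<le> B" if "x \<in> {0..<1}" "M > 0" for x M
  proof -
    have "0 \<le> real M * x" using that by auto
    then have "real M * x = frac (real M * x) + real (nat \<lfloor>real M * x\<rfloor>)"
      by (simp add: frac_def)
    then have "F (real M * x) = F (frac (real M * x))" using per by metis
    then show ?thesis using B [of "frac (real M * x)" x] that by (simp add: frac_lt_1 less_imp_le)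
  qed
  define G where "G x = (\<integral>s. F s x \<partial>circle)" for x
  have Gm [measurable]: "G \<in> borel_measurable borel"
  proof -
    have "(\<lambda>x. \<integral>s. F s x \<partial>circle) \<in> borel_measurable borel" by measurable
    then show ?thesis by (simp add: G_def [abs_def])
  qed
  have Gb: "\<bar>G x\<bar> \<le> B" if "x \<in> {0..1}" for x
    unfolding G_def by (rule abs_integral_circle_le) (use B that in auto)
  obtain M0 :: nat where M0: "1 / d < real M0" using reals_Archimedean2 by blast
  show "\<exists>no. \<forall>M\<ge>no. norm ((\<integral>x. F (real M * x) x \<partial>circle) - (\<integral>x. (\<integral>s. F s x \<partial>circle) \<partial>circle)) < e"
  proof (intro exI [of _ M0] allI impI)
    fix M assume M: "M0 \<le> M"
    have Mpos: "M > 0" using M0 M d by (cases "M = 0") (auto simp: field_simps)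
    have small: "1 / real M < d"
    proof -
      have "1 / d < real M" using M0 M by linarith
      then show ?thesis using d Mpos by (simp add: field_simps)
    qed
    have cell: "(s + real k) / real M \<in> {0..1}" if "s \<in> {0..<1}" "k < M" for s k
    proof -
      have "s + real k \<le> real M" using that by auto
      then show ?thesis using that Mpos by (simp add: field_simps)
    qed
    have "(\<integral>x. F (real M * x) x \<partial>circle) =
        (\<Sum>k<M. \<integral>s. F (real M * ((s + real k) / real M)) ((s + real k) / real M) \<partial>circle) / real M"
      by (rule integral_circle_cells [where B = B]) (use Fb Mpos in auto)
    also have "\<dots> = (\<Sum>k<M. \<integral>s. F s ((s + real k) / real M) \<partial>circle) / real M"
      using Mpos by (simp add: per)
    finally have 1: "(\<integral>x. F (real M * x) x \<partial>circle) = \<dots>" .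
    have 2: "integral\<^sup>L circle G = (\<Sum>k<M. \<integral>y. G ((y + real k) / real M) \<partial>circle) / real M"
      by (rule integral_circle_cells [where B = B]) (use Gb Mpos in auto)
    have 3: "\<bar>(\<integral>s. F s ((s + real k) / real M) \<partial>circle) - (\<integral>y. G ((y + real k) / real M) \<partial>circle)\<bar> \<le> e / 2"
      if k: "k < M" for k
    proof -
      define A where "A = (\<integral>s. F s ((s + real k) / real M) \<partial>circle)"
      have i1: "integrable circle (\<lambda>s. F s ((s + real k) / real M))"
        by (rule integrable_circle [where B = B]) (use B cell k in auto)
      have i2: "integrable circle (\<lambda>y. G ((y + real k) / real M))"
        by (rule integrable_circle [where B = B]) (use Gb cell k in auto)
      have i3: "integrable circle (\<lambda>s. F s x)" if "x \<in> {0..1}" for x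
        by (rule integrable_circle [where B = B]) (use B that in auto)
      have "A - (\<integral>y. G ((y + real k) / real M) \<partial>circle) = (\<integral>y. A - G ((y + real k) / real M) \<partial>circle)"
        using i2 by (subst Bochner_Integration.integral_diff) auto
      also have "\<bar>\<dots>\<bar> \<le> e / 2"
      proof (rule abs_integral_circle_le)
        fix y :: real assume y: "y \<in> {0..<1}"
        have "A - G ((y + real k) / real M) = (\<integral>s. F s ((s + real k) / real M) - F s ((y + real k) / real M) \<partial>circle)"
          unfolding A_def G_def using i1 i3 [OF cell [OF y k]] by (subst Bochner_Integration.integral_diff) auto
        also have "\<bar>\<dots>\<bar> \<le> e / 2"
        proof (rule abs_integral_circle_le)
          fix s :: real assume s: "s \<in> {0..<1}"
          have "(s + real k) / real M - (y + real k) / real M = (s - y) * (1 / real M)"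
            by (simp add: diff_divide_distrib [symmetric])
          then have "\<bar>(s + real k) / real M - (y + real k) / real M\<bar> = \<bar>s - y\<bar> * (1 / real M)"
            by (simp add: abs_mult)
          also have "\<dots> \<le> 1 * (1 / real M)" using s y by (intro mult_right_mono) auto
          also have "\<dots> < d" using small by simp
          finally show "\<bar>F s ((s + real k) / real M) - F s ((y + real k) / real M)\<bar> \<le> e / 2"
            using s cell [OF s k] cell [OF y k] by (intro less_imp_le unif) auto
        qed measurable
        finally show "\<bar>A - G ((y + real k) / real M)\<bar> \<le> e / 2" .
      qed measurable
      finally show ?thesis by (simp add: A_def)
    qed
    have "\<bar>(\<integral>x. F (real M * x) x \<partial>circle) - integral\<^sup>L circle G\<bar> =
        \<bar>\<Sum>k<M. (\<integral>s. F s ((s + real k) / real M) \<partial>circle) - (\<integral>y. G ((y + real k) / real M) \<partial>circle)\<bar> / real M"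
      unfolding 1 2 by (simp add: sum_subtractf diff_divide_distrib [symmetric])
    also have "\<dots> \<le> (\<Sum>k<M. e / 2) / real M"
      using 3 by (intro divide_right_mono order_trans [OF sum_abs] sum_mono) auto
    also have "\<dots> < e" using Mpos e by simp
    finally show "norm ((\<integral>x. F (real M * x) x \<partial>circle) - (\<integral>x. (\<integral>s. F s x \<partial>circle) \<partial>circle)) < e"
      by (simp add: G_def [abs_def])
  qed
qed

text \<open>
  A measurable function is almost everywhere a limit of continuous ones; truncation keeps the bound, so
  that dominated convergence applies to the approximants.
\<close>

lemma approx_continuous_AE:
  fixes g :: "real \<Rightarrow> real"
  assumes gm: "g \<in> borel_measurable lebesgue" and B: "\<And>x. \<bar>g x\<bar> \<le> B"
  obtains h where "\<And>n::nat. continuous_on UNIV (h n)" "\<And>n x. \<bar>h n x\<bar> \<le> B"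
    "AE x in lborel. (\<lambda>n. h n x) \<longlonglongrightarrow> g x"
proof -
  have "g measurable_on UNIV"
    using gm by (rule lebesgue_measurable_imp_measurable_on) simp
  then obtain N h where N: "negligible N" and h: "\<And>n. continuous_on UNIV (h n)"
    and lim: "\<And>x. x \<notin> N \<Longrightarrow> (\<lambda>n::nat. h n x) \<longlonglongrightarrow> g x"
    unfolding measurable_on_def by auto
  have B0: "0 \<le> B" using B [of 0] by linarith
  show ?thesis
  proof (rule that [of "\<lambda>n x. max (-B) (min B (h n x))"])
    show "continuous_on UNIV (\<lambda>x. max (-B) (min B (h n x)))" for n
      using h by (intro continuous_intros)
    show "\<bar>max (- B) (min B (h n x))\<bar> \<le> B" for n x using B0 by (simp add: abs_le_iff)
    have "AE x in lebesgue. x \<notin> N"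
      using N by (auto simp: negligible_iff_null_sets intro: AE_not_in)
    then have "AE x in lborel. x \<notin> N" by (simp add: AE_completion_iff)
    then show "AE x in lborel. (\<lambda>n. max (- B) (min B (h n x))) \<longlonglongrightarrow> g x"
    proof eventually_elim
      case (elim x)
      have "(\<lambda>n. max (- B) (min B (h n x))) \<longlonglongrightarrow> max (-B) (min B (g x))"
        using lim [OF elim] by (intro tendsto_intros)
      also have "max (-B) (min B (g x)) = g x" using B [of x] by (simp add: abs_le_iff)
      finally show ?case .
    qed
  qed
qed

text \<open>
  The factor \<open>g\<close> is only measurable. Since \<open>F\<close> is bounded uniformly in \<open>M\<close>, replacing \<open>g\<close> by an
  \<open>L\<^sup>1\<close>-close continuous function changes both sides by an amount independent of \<open>M\<close>.
\<close>

lemma oscillation_limit: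
  fixes F :: "real \<Rightarrow> real \<Rightarrow> real"
  assumes cont: "continuous_on UNIV (\<lambda>(s,x). F s x)" and per: "\<And>s k. F (s + real k) = F s"
    and C: "\<And>s x. \<bar>F s x\<bar> \<le> C" and g: "torus_fun g"
  shows "(\<lambda>M. \<integral>x. g x * F (real M * x) x \<partial>circle) \<longlonglongrightarrow> (\<integral>x. g x * (\<integral>s. F s x \<partial>circle) \<partial>circle)"
proof (rule LIMSEQ_I)
  fix e :: real assume e: "e > 0"
  have gm [measurable]: "g \<in> borel_measurable borel" using g by (rule torus_fun_measurable)
  obtain B where B: "\<And>x. \<bar>g x\<bar> \<le> B" using torus_fun_bounded [OF g] by blast
  have C0: "C \<ge> 0" using C [of 0 0] by linarith
  have pm [measurable]: "(\<lambda>(s,x). F s x) \<in> borel_measurable (borel \<Otimes>\<^sub>M borel)"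
    by (rule measurable_of_continuous_pair [OF cont])
  have meas [measurable]: "(\<lambda>x. F (u x) (v x)) \<in> borel_measurable borel"
    if [measurable]: "u \<in> borel_measurable borel" "v \<in> borel_measurable borel" for u v
    using measurable_compose [OF measurable_Pair [OF that] pm] by simp
  have "g \<in> borel_measurable lebesgue" by (rule measurable_completion) simp
  then obtain h where h: "\<And>n::nat. continuous_on UNIV (h n)" and hB: "\<And>n x. \<bar>h n x\<bar> \<le> B"
    and lim: "AE x in lborel. (\<lambda>n. h n x) \<longlonglongrightarrow> g x"
    using approx_continuous_AE [of g B] B by blast
  have hm [measurable]: "h n \<in> borel_measurable borel" for n
    using h by (rule borel_measurable_continuous_onI)
  have "(\<lambda>n. \<integral>x. \<bar>g x - h n x\<bar> \<partial>circle) \<longlonglongrightarrow> (\<integral>x. 0 \<partial>circle)"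
  proof (rule integral_dominated_convergence [where w = "\<lambda>x. 2 * B"])
    show "AE x in circle. (\<lambda>n. \<bar>g x - h n x\<bar>) \<longlonglongrightarrow> 0"
      using AE_circle_of_lborel [OF lim]
    proof eventually_elim
      case (elim x)
      have "(\<lambda>n. \<bar>g x - h n x\<bar>) \<longlonglongrightarrow> \<bar>g x - g x\<bar>" using elim by (intro tendsto_intros)
      then show ?case by simp
    qed
    show "AE x in circle. norm \<bar>g x - h n x\<bar> \<le> 2 * B" for n
      using B hB by (intro AE_I2) (smt (verit) real_norm_def)
  qed auto
  then have "(\<lambda>n. \<integral>x. \<bar>g x - h n x\<bar> \<partial>circle) \<longlonglongrightarrow> 0" by simp
  then have "\<forall>\<^sub>F n in sequentially. (\<integral>x. \<bar>g x - h n x\<bar> \<partial>circle) < e / (3 * (C + 1))"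
    using e C0 by (intro order_tendstoD) auto
  then obtain n where n: "(\<integral>x. \<bar>g x - h n x\<bar> \<partial>circle) < e / (3 * (C + 1))"
    by (auto dest: eventually_happens)
  have key: "\<bar>(\<integral>x. g x * f x \<partial>circle) - (\<integral>x. h n x * f x \<partial>circle)\<bar> \<le> e / 3"
    if [measurable]: "f \<in> borel_measurable borel" and f: "\<And>x. \<bar>f x\<bar> \<le> C" for f
  proof -
    have b: "\<bar>u x * f x\<bar> \<le> B * C" if "\<And>x. \<bar>u x\<bar> \<le> B" for u x
      using that [of x] f [of x] by (simp add: abs_mult mult_mono')
    have i: "integrable circle (\<lambda>x. u x * f x)" if [measurable]: "u \<in> borel_measurable borel" and "\<And>x. \<bar>u x\<bar> \<le> B" for u
      by (rule integrable_circle [where B = "B * C"]) (use b [of u] that in auto)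
    have "(\<integral>x. g x * f x \<partial>circle) - (\<integral>x. h n x * f x \<partial>circle) = (\<integral>x. g x * f x - h n x * f x \<partial>circle)"
      by (subst Bochner_Integration.integral_diff) (use i B hB in auto)
    also have "\<bar>\<dots>\<bar> \<le> (\<integral>x. \<bar>g x * f x - h n x * f x\<bar> \<partial>circle)" by (rule integral_abs_bound)
    also have "\<dots> \<le> (\<integral>x. C * \<bar>g x - h n x\<bar> \<partial>circle)"
    proof (rule integral_circle_mono)
      show "integrable circle (\<lambda>x. \<bar>g x * f x - h n x * f x\<bar>)"
        by (intro integrable_abs Bochner_Integration.integrable_diff i) (use B hB in auto)
      show "integrable circle (\<lambda>x. C * \<bar>g x - h n x\<bar>)"
        by (intro integrable_mult_right integrable_abs Bochner_Integration.integrable_diff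
              integrable_circle [where B = B]) (use B hB in auto)
      show "\<bar>g x * f x - h n x * f x\<bar> \<le> C * \<bar>g x - h n x\<bar>" for x
      proof -
        have "\<bar>g x * f x - h n x * f x\<bar> = \<bar>f x\<bar> * \<bar>g x - h n x\<bar>"
          by (simp add: left_diff_distrib [symmetric] abs_mult)
        also have "\<dots> \<le> C * \<bar>g x - h n x\<bar>" using f [of x] by (rule mult_right_mono) simp
        finally show ?thesis .
      qed
    qed
    also have "\<dots> = C * (\<integral>x. \<bar>g x - h n x\<bar> \<partial>circle)" by simp
    also have "\<dots> \<le> C * (e / (3 * (C + 1)))" using n C0 by (intro mult_left_mono) auto
    also have "\<dots> \<le> e / 3" using C0 e by (simp add: field_simps)
    finally show ?thesis .
  qed
  have "(\<lambda>M. \<integral>x. h n x * F (real M * x) x \<partial>circle) \<longlonglongrightarrow> (\<integral>x. (\<integral>s. h n x * F s x \<partial>circle) \<partial>circle)"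
  proof (rule oscillation_limit_continuous [where F = "\<lambda>s x. h n x * F s x"])
    have "continuous_on UNIV (\<lambda>p. h n (snd p))"
      by (rule continuous_on_compose2 [OF h]) (auto intro: continuous_intros)
    then show "continuous_on UNIV (\<lambda>(s, x). h n x * F s x)"
      using cont unfolding case_prod_beta by (intro continuous_intros)
  qed (simp add: per)
  then have "(\<lambda>M. \<integral>x. h n x * F (real M * x) x \<partial>circle) \<longlonglongrightarrow> (\<integral>x. h n x * (\<integral>s. F s x \<partial>circle) \<partial>circle)"
    by simp
  then obtain M0 where M0: "\<And>M. M \<ge> M0 \<Longrightarrow>
      \<bar>(\<integral>x. h n x * F (real M * x) x \<partial>circle) - (\<integral>x. h n x * (\<integral>s. F s x \<partial>circle) \<partial>circle)\<bar> < e / 3"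
    using LIMSEQ_D [of _ _ "e / 3"] e by fastforce
  show "\<exists>no. \<forall>M\<ge>no. norm ((\<integral>x. g x * F (real M * x) x \<partial>circle) - (\<integral>x. g x * (\<integral>s. F s x \<partial>circle) \<partial>circle)) < e"
  proof (intro exI [of _ M0] allI impI)
    fix M assume M: "M0 \<le> M"
    have a: "\<bar>(\<integral>x. g x * F (real M * x) x \<partial>circle) - (\<integral>x. h n x * F (real M * x) x \<partial>circle)\<bar> \<le> e / 3"
      by (rule key) (use C in auto)
    have b: "\<bar>(\<integral>x. g x * (\<integral>s. F s x \<partial>circle) \<partial>circle) - (\<integral>x. h n x * (\<integral>s. F s x \<partial>circle) \<partial>circle)\<bar> \<le> e / 3"
    proof (rule key)
      show "(\<lambda>x. \<integral>s. F s x \<partial>circle) \<in> borel_measurable borel" by measurable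
      show "\<bar>\<integral>s. F s x \<partial>circle\<bar> \<le> C" for x by (rule abs_integral_circle_le) (use C in auto)
    qed
    show "norm ((\<integral>x. g x * F (real M * x) x \<partial>circle) - (\<integral>x. g x * (\<integral>s. F s x \<partial>circle) \<partial>circle)) < e"
      unfolding real_norm_def using a b M0 [OF M] by linarith
  qed
qed

section \<open>Idempotents with large gaps\<close>

lemma character_add: "character (h + k) t = character h t * character k t"
  by (simp add: character_def exp_add [symmetric] algebra_simps)

lemma character_mult: "character (M * h) t = character h (real M * t)"
  by (simp add: character_def algebra_simps)

lemma character_cis: "character h t = cis (2 * pi * real h * t)"
  by (simp add: character_def cis_conv_exp mult_ac)

lemma norm_character [simp]: "cmod (character h t) = 1"
  by (simp add: character_cis)

lemma character_at_0 [simp]: "character h 0 = 1"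
  by (simp add: character_cis)

lemma character_periodic: "character h (t + 1) = character h t"
proof -
  have "character h (t + 1) = character h t * cis (2 * pi * real h)"
    unfolding character_cis cis_mult by (simp only: distrib_left mult_1_right)
  moreover have "cis (2 * pi * real h) = 1" by (rule cis_multiple_2pi) simp
  ultimately show ?thesis by simp
qed

lemma continuous_character [continuous_intros]: "continuous_on A (character h)"
  unfolding character_def by (intro continuous_intros)

definition abs_idem :: "nat set \<Rightarrow> real \<Rightarrow> real" where
  "abs_idem H t = cmod (idempotent_of H t)"

lemma abs_idem_nonneg: "abs_idem H t \<ge> 0"
  by (simp add: abs_idem_def)

lemma torus_cont_abs_idem: "torus_cont (abs_idem H)"
proof -
  have "continuous_on UNIV (abs_idem H)"
    unfolding abs_idem_def [abs_def] idempotent_of_def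
    by (intro continuous_on_norm continuous_on_sum continuous_character)
  moreover have "periodic (abs_idem H)"
    unfolding periodic_def abs_idem_def idempotent_of_def character_periodic by simp
  ultimately show ?thesis by (simp add: torus_cont_def)
qed

text \<open>
  All pairs of elements are compared, not only consecutive ones as in \<open>gaps_at_least\<close>; this form is
  easier to propagate through sums of sets.
\<close>

definition spread :: "nat \<Rightarrow> nat set \<Rightarrow> bool" where
  "spread N H \<longleftrightarrow> (\<forall>h\<in>H. \<forall>k\<in>H. h < k \<longrightarrow> h + N \<le> k)"

lemma spread_mono: "spread N H \<Longrightarrow> K \<le> N \<Longrightarrow> spread K H"
  unfolding spread_def by fastforce

lemma spread_gaps: "spread N H \<Longrightarrow> gaps_at_least N H"
  by (simp add: spread_def gaps_at_least_def)

text \<open>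
  The product of two idempotents is an idempotent exactly when no frequency of the product is hit
  twice.
\<close>

lemma abs_idem_image:
  assumes inj: "inj_on (\<lambda>(h,k). a * h + b * k) (H \<times> K)"
  shows "abs_idem ((\<lambda>(h,k). a * h + b * k) ` (H \<times> K)) t = abs_idem H (real a * t) * abs_idem K (real b * t)"
proof -
  have "idempotent_of ((\<lambda>(h,k). a * h + b * k) ` (H \<times> K)) t =
      (\<Sum>(h,k)\<in>H \<times> K. character h (real a * t) * character k (real b * t))"
    unfolding idempotent_of_def
    by (subst sum.reindex [OF inj]) (auto simp: character_add character_mult intro!: sum.cong)
  also have "\<dots> = idempotent_of H (real a * t) * idempotent_of K (real b * t)"
    unfolding idempotent_of_def by (simp add: sum_product sum.cartesian_product)
  finally show ?thesis by (simp add: abs_idem_def norm_mult)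
qed

text \<open>
  The gaps of \<open>K\<close> exceed the diameter of \<open>H\<close>, so sums are ordered first by their part in \<open>K\<close>.
\<close>

lemma spread_sumset:
  assumes H: "\<And>h. h \<in> H \<Longrightarrow> h \<le> m" and "N \<ge> 1" "spread N H" "spread (N + m) K"
  shows "inj_on (\<lambda>(h,k). 1 * h + 1 * k) (H \<times> K)"
    and "spread N ((\<lambda>(h,k). 1 * h + 1 * k) ` (H \<times> K))"
proof -
  have *: "h + k + N \<le> h' + k'"
    if "h \<in> H" "h' \<in> H" "k \<in> K" "k' \<in> K" "h + k < h' + k' \<or> h + k = h' + k' \<and> (h,k) \<noteq> (h',k') \<and> k \<le> k'" for h h' k k'
  proof -
    have "h \<le> m" "h' \<le> m" using H that by auto
    moreover have "k < k' \<Longrightarrow> k + (N + m) \<le> k'" "k' < k \<Longrightarrow> k' + (N + m) \<le> k" "h < h' \<Longrightarrow> h + N \<le> h'"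
      using assms that unfolding spread_def by blast+
    ultimately show ?thesis using that(5) \<open>N \<ge> 1\<close>
      by (cases k k' rule: linorder_cases) auto
  qed
  show "inj_on (\<lambda>(h,k). 1 * h + 1 * k) (H \<times> K)"
  proof (rule inj_onI, clarsimp)
    fix h k h' k' assume a: "h \<in> H" "k \<in> K" "h' \<in> H" "k' \<in> K" "h + k = h' + k'"
    show "h = h' \<and> k = k'"
    proof (rule ccontr)
      assume "\<not> (h = h' \<and> k = k')"
      then show False using * [of h h' k k'] * [of h' h k' k] a \<open>N \<ge> 1\<close> by (cases "k \<le> k'") auto
    qed
  qed
  show "spread N ((\<lambda>(h,k). 1 * h + 1 * k) ` (H \<times> K))"
    unfolding spread_def using * by auto
qed

text \<open>
  Here \<open>M h + (M + 1) k = M (h + k) + k\<close> with \<open>k\<close> small compared to \<open>M\<close>: sums are ordered first by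
  \<open>h + k\<close> and then by \<open>k\<close>, which together determine \<open>h\<close>.
\<close>

lemma spread_skew_sumset:
  assumes K: "\<And>k. k \<in> K \<Longrightarrow> k \<le> m" and "N \<ge> 1" "spread N H" "spread N K" and M: "M \<ge> m + N"
  shows "inj_on (\<lambda>(h,k). M * h + (M + 1) * k) (H \<times> K)"
    and "spread N ((\<lambda>(h,k). M * h + (M + 1) * k) ` (H \<times> K))"
proof -
  have eq: "M * h + (M + 1) * k = M * (h + k) + k" for h k by (simp add: algebra_simps)
  have lt: "M * a + k + N \<le> M * b + k'" if "a < b" "k \<le> m" for a b k k'
  proof -
    have "M * (a + 1) \<le> M * b" using that by (intro mult_le_mono2) auto
    then show ?thesis using M that by (simp add: algebra_simps)
  qed
  have *: "M * (h + k) + k + N \<le> M * (h' + k') + k'"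
    if "h \<in> H" "h' \<in> H" "k \<in> K" "k' \<in> K" "M * (h + k) + k < M * (h' + k') + k'" for h h' k k'
  proof -
    consider "h + k < h' + k'" | "h + k = h' + k'" | "h' + k' < h + k" by linarith
    then show ?thesis
    proof cases
      case 1 then show ?thesis using lt K that by blast
    next
      case 2
      then have "k < k'" using that by simp
      then show ?thesis using 2 assms that unfolding spread_def by fastforce
    next
      case 3
      then show ?thesis using lt [of "h' + k'" "h + k" k' k] K that by fastforce
    qed
  qed
  show "inj_on (\<lambda>(h,k). M * h + (M + 1) * k) (H \<times> K)"
  proof (rule inj_onI, clarify)
    fix h k h' k' assume a: "h \<in> H" "k \<in> K" "h' \<in> H" "k' \<in> K"
      and "M * h + (M + 1) * k = M * h' + (M + 1) * k'"
    then have e: "M * (h + k) + k = M * (h' + k') + k'" by (simp only: eq)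
    have "h + k = h' + k'"
      using lt [of "h + k" "h' + k'" k k'] lt [of "h' + k'" "h + k" k' k] e K a \<open>N \<ge> 1\<close>
      by (cases "h + k" "h' + k'" rule: linorder_cases) force+
    then show "h = h' \<and> k = k'" using e by auto
  qed
  show "spread N ((\<lambda>(h,k). M * h + (M + 1) * k) ` (H \<times> K))"
    unfolding spread_def using * by (auto simp only: eq split_beta)
qed

section \<open>Attainable weights\<close>

text \<open>
  A weak limit of scaled moduli of idempotents, with the convergence spelled out for finitely
  many test functions at a time. Choosing the idempotent after the test functions matters: in
  products and correlations the test functions for the second factor depend on the idempotent chosen
  for the first.
\<close>

definition attainable :: "(real \<Rightarrow> real) \<Rightarrow> bool" where
  "attainable w \<longleftrightarrow> torus_cont w \<and>
     (\<forall>T N e. finite T \<and> (\<forall>g\<in>T. torus_fun g) \<and> e > 0 \<longrightarrow>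
       (\<exists>H c. finite H \<and> H \<noteq> {} \<and> spread N H \<and> c > 0 \<and>
          (\<forall>g\<in>T. \<bar>c * (\<integral>x. g x * abs_idem H x \<partial>circle) - (\<integral>x. g x * w x \<partial>circle)\<bar> < e)))"

lemma attainable_cont: "attainable w \<Longrightarrow> torus_cont w"
  by (simp add: attainable_def)

lemma attainableE:
  assumes "attainable w" "finite T" "\<And>g. g \<in> T \<Longrightarrow> torus_fun g" "e > 0"
  obtains H c where "finite H" "H \<noteq> {}" "spread N H" "c > 0"
    "\<And>g. g \<in> T \<Longrightarrow> \<bar>c * (\<integral>x. g x * abs_idem H x \<partial>circle) - (\<integral>x. g x * w x \<partial>circle)\<bar> < e"
proof -
  have "finite T \<and> (\<forall>g\<in>T. torus_fun g) \<and> e > 0" using assms by blast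
  then have "\<exists>H c. finite H \<and> H \<noteq> {} \<and> spread N H \<and> c > 0 \<and>
      (\<forall>g\<in>T. \<bar>c * (\<integral>x. g x * abs_idem H x \<partial>circle) - (\<integral>x. g x * w x \<partial>circle)\<bar> < e)"
    by (rule assms(1) [unfolded attainable_def, THEN conjunct2, THEN spec, THEN spec, THEN spec, THEN mp])
  then show ?thesis using that by (elim exE conjE) (rule that, assumption+, erule bspec)
qed

lemma attainableI:
  assumes "torus_cont w"
    and "\<And>T N e. \<lbrakk>finite T; \<forall>g\<in>T. torus_fun g; e > 0\<rbrakk> \<Longrightarrow>
      \<exists>H c. finite H \<and> H \<noteq> {} \<and> spread N H \<and> c > 0 \<and>
        (\<forall>g\<in>T. \<bar>c * (\<integral>x. g x * abs_idem H x \<partial>circle) - (\<integral>x. g x * w x \<partial>circle)\<bar> < e)"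
  shows "attainable w"
  unfolding attainable_def by (intro conjI allI impI assms) auto

lemma attainable_one: "attainable (\<lambda>x. 1)"
proof (rule attainableI [OF torus_cont_const])
  fix T :: "(real \<Rightarrow> real) set" and N :: nat and e :: real
  assume e: "e > 0"
  have "abs_idem {0} x = 1" for x by (simp add: abs_idem_def idempotent_of_def)
  then show "\<exists>H c. finite H \<and> H \<noteq> {} \<and> spread N H \<and> c > 0 \<and>
      (\<forall>g\<in>T. \<bar>c * (\<integral>x. g x * abs_idem H x \<partial>circle) - (\<integral>x. g x * 1 \<partial>circle)\<bar> < e)"
    using e by (intro exI [of _ "{0}"] exI [of _ 1]) (auto simp: spread_def)
qed

lemma attainable_scale:
  assumes w: "attainable w" and d: "d > 0"
  shows "attainable (\<lambda>x. d * w x)"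
proof (rule attainableI)
  show "\<exists>H c. finite H \<and> H \<noteq> {} \<and> spread N H \<and> c > 0 \<and>
      (\<forall>g\<in>T. \<bar>c * (\<integral>x. g x * abs_idem H x \<partial>circle) - (\<integral>x. g x * (d * w x) \<partial>circle)\<bar> < e)"
    if T: "finite T" "\<forall>g\<in>T. torus_fun g" "e > 0" for T N e
  proof -
    obtain H c where H: "finite H" "H \<noteq> {}" "spread N H" "c > 0"
      and a: "\<And>g. g \<in> T \<Longrightarrow> \<bar>c * (\<integral>x. g x * abs_idem H x \<partial>circle) - (\<integral>x. g x * w x \<partial>circle)\<bar> < e / d"
      using attainableE [OF w T(1) T(2) [rule_format] divide_pos_pos [OF T(3) d], where N = N] by blast
    have "\<bar>d * c * (\<integral>x. g x * abs_idem H x \<partial>circle) - (\<integral>x. g x * (d * w x) \<partial>circle)\<bar> < e" if "g \<in> T" for g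
    proof -
      have e1: "(\<integral>x. g x * (d * w x) \<partial>circle) = d * (\<integral>x. g x * w x \<partial>circle)"
        by (simp add: mult.left_commute)
      have "d * c * (\<integral>x. g x * abs_idem H x \<partial>circle) - (\<integral>x. g x * (d * w x) \<partial>circle) =
          d * (c * (\<integral>x. g x * abs_idem H x \<partial>circle) - (\<integral>x. g x * w x \<partial>circle))"
        unfolding e1 by (simp add: algebra_simps)
      then have "\<bar>d * c * (\<integral>x. g x * abs_idem H x \<partial>circle) - (\<integral>x. g x * (d * w x) \<partial>circle)\<bar> =
          d * \<bar>c * (\<integral>x. g x * abs_idem H x \<partial>circle) - (\<integral>x. g x * w x \<partial>circle)\<bar>"
        using d by (simp add: abs_mult)
      also have "\<dots> < d * (e / d)" using a [OF that] d by (intro mult_strict_left_mono) auto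
      finally show ?thesis using d by simp
    qed
    then show ?thesis using H d by (intro exI [of _ H] exI [of _ "d * c"]) auto
  qed
  show "torus_cont (\<lambda>x. d * w x)"
    by (rule torus_cont_mult [OF torus_cont_const attainable_cont [OF w]])
qed

lemma finite_tests_bound:
  assumes "finite T" "\<And>g. g \<in> T \<Longrightarrow> torus_fun g"
  obtains B where "B > 0" "\<And>g x. g \<in> T \<Longrightarrow> \<bar>g x\<bar> \<le> B"
proof -
  have "\<exists>B>0. \<forall>g\<in>T. \<forall>x. \<bar>g x\<bar> \<le> B" using assms
  proof (induction T rule: finite_induct)
    case empty then show ?case by (intro exI [of _ 1]) auto
  next
    case (insert f T)
    have "\<exists>B>0. \<forall>g\<in>T. \<forall>x. \<bar>g x\<bar> \<le> B"
      by (rule insert.IH) (rule insert.prems, simp)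
    then obtain B where B: "B > 0" "\<forall>g\<in>T. \<forall>x. \<bar>g x\<bar> \<le> B" by blast
    have "torus_fun f" by (rule insert.prems) simp
    then obtain A where A: "\<And>x. \<bar>f x\<bar> \<le> A" using torus_fun_bounded by blast
    show ?case using B A by (intro exI [of _ "max A B"]) (auto simp: le_max_iff_disj)
  qed
  then show ?thesis using that by blast
qed

lemma attainable_limit:
  assumes w: "torus_cont w" and ap: "\<And>e. e > 0 \<Longrightarrow> \<exists>v. attainable v \<and> (\<forall>x. \<bar>v x - w x\<bar> \<le> e)"
  shows "attainable w"
proof (rule attainableI)
  show "\<exists>H c. finite H \<and> H \<noteq> {} \<and> spread N H \<and> c > 0 \<and>
      (\<forall>g\<in>T. \<bar>c * (\<integral>x. g x * abs_idem H x \<partial>circle) - (\<integral>x. g x * w x \<partial>circle)\<bar> < e)"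
    if T: "finite T" "\<forall>g\<in>T. torus_fun g" "e > 0" for T N e
  proof -
    obtain B where B: "B > 0" "\<And>g x. g \<in> T \<Longrightarrow> \<bar>g x\<bar> \<le> B" using finite_tests_bound T by blast
    obtain v where v: "attainable v" and vw: "\<And>x. \<bar>v x - w x\<bar> \<le> e / (2 * B)"
      using ap [of "e / (2 * B)"] B T by auto
    obtain H c where H: "finite H" "H \<noteq> {}" "spread N H" "c > 0"
      and a: "\<And>g. g \<in> T \<Longrightarrow> \<bar>c * (\<integral>x. g x * abs_idem H x \<partial>circle) - (\<integral>x. g x * v x \<partial>circle)\<bar> < e / 2"
      using attainableE [OF v T(1) T(2) [rule_format] half_gt_zero [OF T(3)], where N = N] by blast
    have "\<bar>c * (\<integral>x. g x * abs_idem H x \<partial>circle) - (\<integral>x. g x * w x \<partial>circle)\<bar> < e" if g: "g \<in> T" for g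
    proof -
      have gt: "torus_fun g" using T g by blast
      have gm: "g \<in> borel_measurable borel" "v \<in> borel_measurable borel" "w \<in> borel_measurable borel"
        using gt torus_cont_fun [OF attainable_cont [OF v]] torus_cont_fun [OF w] by (auto intro: torus_fun_measurable)
      have "(\<integral>x. g x * v x \<partial>circle) - (\<integral>x. g x * w x \<partial>circle) = (\<integral>x. g x * v x - g x * w x \<partial>circle)"
        using torus_fun_integrable [OF torus_fun_mult [OF gt torus_cont_fun [OF attainable_cont [OF v]]]]
          torus_fun_integrable [OF torus_fun_mult [OF gt torus_cont_fun [OF w]]]
        by (subst Bochner_Integration.integral_diff) auto
      also have "\<bar>\<dots>\<bar> \<le> B * (e / (2 * B))"
      proof (rule abs_integral_circle_le)
        show "\<bar>g x * v x - g x * w x\<bar> \<le> B * (e / (2 * B))" for x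
          using B(2) [OF g, of x] vw [of x] B(1)
          by (simp add: right_diff_distrib [symmetric] abs_mult del: times_divide_eq_right) (intro mult_mono', auto)
      qed (use gm in measurable)
      also have "\<dots> = e / 2" using B by simp
      finally show ?thesis using a [OF g] by linarith
    qed
    then show ?thesis using H by blast
  qed
  show "torus_cont w" by (rule w)
qed

text \<open>
  First \<open>v\<close> is approximated against the tests \<open>g w\<close>; the resulting modulus \<open>\<bar>f\<bar>\<close> is bounded,
  so \<open>w\<close> may then be approximated against the tests \<open>g \<bar>f\<bar>\<close>.
\<close>

lemma attainable_mult:
  assumes v: "attainable v" and w: "attainable w"
  shows "attainable (\<lambda>x. v x * w x)"
proof (rule attainableI)
  note vc = attainable_cont [OF v] and wc = attainable_cont [OF w]
  show "\<exists>H c. finite H \<and> H \<noteq> {} \<and> spread N H \<and> c > 0 \<and>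
      (\<forall>g\<in>T. \<bar>c * (\<integral>x. g x * abs_idem H x \<partial>circle) - (\<integral>x. g x * (v x * w x) \<partial>circle)\<bar> < e)"
    if T: "finite T" "\<forall>g\<in>T. torus_fun g" "e > 0" for T N e
  proof -
    let ?T1 = "(\<lambda>g x. g x * w x) ` T"
    have T1: "torus_fun f" if "f \<in> ?T1" for f
      using that T torus_fun_mult torus_cont_fun [OF wc] by blast
    obtain H c where H: "finite H" "H \<noteq> {}" "spread (N + 1) H" "c > 0"
      and a: "\<And>g. g \<in> ?T1 \<Longrightarrow> \<bar>c * (\<integral>x. g x * abs_idem H x \<partial>circle) - (\<integral>x. g x * v x \<partial>circle)\<bar> < e / 2"
      using attainableE [OF v finite_imageI [OF T(1)] T1 half_gt_zero [OF T(3)], where N = "N + 1"] by blast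
    define m where "m = Max H"
    have m: "h \<le> m" if "h \<in> H" for h using H that by (simp add: m_def)
    \<comment> \<open>The tests for \<open>w\<close> involve the idempotent just chosen for \<open>v\<close>.\<close>
    let ?T2 = "(\<lambda>g x. g x * (c * abs_idem H x)) ` T"
    have T2: "torus_fun f" if "f \<in> ?T2" for f
      using that T torus_fun_mult torus_fun_cmult torus_cont_fun [OF torus_cont_abs_idem] by blast
    obtain K d where K: "finite K" "K \<noteq> {}" "spread (N + 1 + m) K" "d > 0"
      and b: "\<And>g. g \<in> ?T2 \<Longrightarrow> \<bar>d * (\<integral>x. g x * abs_idem K x \<partial>circle) - (\<integral>x. g x * w x \<partial>circle)\<bar> < e / 2"
      using attainableE [OF w finite_imageI [OF T(1)] T2 half_gt_zero [OF T(3)], where N = "N + 1 + m"] by blast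
    let ?L = "(\<lambda>(h,k). 1 * h + 1 * k) ` (H \<times> K)"
    have inj: "inj_on (\<lambda>(h,k). 1 * h + 1 * k) (H \<times> K)" and sp: "spread (N + 1) ?L"
      using spread_sumset [of H m "N + 1" K] m H K by auto
    have L: "abs_idem ?L x = abs_idem H x * abs_idem K x" for x
      using abs_idem_image [OF inj, of x] by simp
    have "\<bar>c * d * (\<integral>x. g x * abs_idem ?L x \<partial>circle) - (\<integral>x. g x * (v x * w x) \<partial>circle)\<bar> < e" if g: "g \<in> T" for g
    proof -
      have "\<bar>c * (\<integral>x. (g x * w x) * abs_idem H x \<partial>circle) - (\<integral>x. (g x * w x) * v x \<partial>circle)\<bar> < e / 2"
        using a g by blast
      moreover have "\<bar>d * (\<integral>x. (g x * (c * abs_idem H x)) * abs_idem K x \<partial>circle) - (\<integral>x. (g x * (c * abs_idem H x)) * w x \<partial>circle)\<bar> < e / 2"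
        using b g by blast
      moreover have "(\<integral>x. (g x * (c * abs_idem H x)) * w x \<partial>circle) = c * (\<integral>x. (g x * w x) * abs_idem H x \<partial>circle)"
        by (subst integral_mult_right_zero [symmetric]) (simp add: mult_ac)
      moreover have "d * (\<integral>x. (g x * (c * abs_idem H x)) * abs_idem K x \<partial>circle) = c * d * (\<integral>x. g x * abs_idem ?L x \<partial>circle)"
        unfolding L by (subst (1 2) integral_mult_right_zero [symmetric]) (simp add: mult_ac)
      moreover have "(\<integral>x. (g x * w x) * v x \<partial>circle) = (\<integral>x. g x * (v x * w x) \<partial>circle)"
        by (simp add: mult_ac)
      ultimately show ?thesis by linarith
    qed
    then show ?thesis
      using H K sp spread_mono [OF sp, of N] by (intro exI [of _ ?L] exI [of _ "c * d"]) auto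
  qed
  show "torus_cont (\<lambda>x. v x * w x)" by (rule torus_cont_mult [OF vc wc])
qed

lemma attainable_power: "attainable w \<Longrightarrow> attainable (\<lambda>x. w x ^ n)"
proof (induction n)
  case 0 then show ?case using attainable_one by simp
next
  case (Suc n) then show ?case using attainable_mult [of w "\<lambda>x. w x ^ n"] by simp
qed

section \<open>Correlations of attainable weights\<close>

lemma torus_cont_integral_param:
  assumes p: "torus_fun p" and q: "torus_cont q"
  shows "torus_cont (\<lambda>x. \<integral>s. p s * q (real a * s + real b * x) \<partial>circle)"
proof -
  have pm [measurable]: "p \<in> borel_measurable borel" using p by (rule torus_fun_measurable)
  have qc: "continuous_on UNIV q" and qp: "periodic q" using q by (auto simp: torus_cont_def)
  have qm [measurable]: "q \<in> borel_measurable borel" using qc by (rule borel_measurable_continuous_onI)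
  obtain A where A: "\<And>x. \<bar>p x\<bar> \<le> A" using torus_fun_bounded [OF p] by blast
  obtain B where B: "\<And>x. \<bar>q x\<bar> \<le> B" using torus_fun_bounded [OF torus_cont_fun [OF q]] by blast
  have "(\<lambda>n. \<integral>s. p s * q (real a * s + real b * u n) \<partial>circle) \<longlonglongrightarrow> (\<integral>s. p s * q (real a * s + real b * x) \<partial>circle)"
    if u: "u \<longlonglongrightarrow> x" for u x
  proof (rule integral_dominated_convergence [where w = "\<lambda>x. A * B"])
    show "AE s in circle. (\<lambda>n. p s * q (real a * s + real b * u n)) \<longlonglongrightarrow> p s * q (real a * s + real b * x)"
    proof (rule AE_I2)
      fix s
      have "isCont q (real a * s + real b * x)" using qc by (simp add: continuous_on_eq_continuous_at)
      then have "(\<lambda>n. q (real a * s + real b * u n)) \<longlonglongrightarrow> q (real a * s + real b * x)"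
        by (rule isCont_tendsto_compose) (intro tendsto_intros u)
      then show "(\<lambda>n. p s * q (real a * s + real b * u n)) \<longlonglongrightarrow> p s * q (real a * s + real b * x)"
        by (rule tendsto_mult_left)
    qed
    show "AE s in circle. norm (p s * q (real a * s + real b * u n)) \<le> A * B" for n
      using A B by (intro AE_I2) (simp add: abs_mult mult_mono')
  qed auto
  then have "continuous_on UNIV (\<lambda>x. \<integral>s. p s * q (real a * s + real b * x) \<partial>circle)"
    unfolding continuous_on_sequentially by (simp add: o_def)
  moreover have "periodic (\<lambda>x. \<integral>s. p s * q (real a * s + real b * x) \<partial>circle)"
    unfolding periodic_def
  proof
    fix x
    have "q (real a * s + real b * (x + 1)) = q (real a * s + real b * x)" for s
    proof -
      have e: "real a * s + real b * (x + 1) = (real a * s + real b * x) + real b" by (simp add: algebra_simps)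
      show ?thesis unfolding e by (rule periodic_add_nat [OF qp])
    qed
    then show "(\<integral>s. p s * q (real a * s + real b * (x + 1)) \<partial>circle) = (\<integral>s. p s * q (real a * s + real b * x) \<partial>circle)"
      by (simp only:)
  qed
  ultimately show ?thesis by (simp only: torus_cont_def)
qed

lemma torus_cont_correlation:
  assumes "torus_fun p" "torus_cont q"
  shows "torus_cont (\<lambda>x. \<integral>s. p s * q (s + x) \<partial>circle)"
  using torus_cont_integral_param [OF assms, of 1 1] by simp

text \<open>
  The form of fast averaging that serves idempotents of the type \<open>f\<^sub>1 (M x) f\<^sub>2 ((j M + l) x)\<close>.
\<close>

lemma oscillation_limit_product:
  assumes p: "torus_cont p" and q: "torus_cont q" and g: "torus_fun g"
  shows "(\<lambda>M. \<integral>x. g x * (p (real M * x) * q (real (j * M + l) * x)) \<partial>circle) \<longlonglongrightarrow>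
      (\<integral>x. g x * (\<integral>s. p s * q (real j * s + real l * x) \<partial>circle) \<partial>circle)"
proof -
  have pc: "continuous_on UNIV p" and pp: "periodic p" using p by (auto simp: torus_cont_def)
  have qc: "continuous_on UNIV q" and qp: "periodic q" using q by (auto simp: torus_cont_def)
  obtain A where A: "\<And>x. \<bar>p x\<bar> \<le> A" using torus_fun_bounded [OF torus_cont_fun [OF p]] by blast
  obtain B where B: "\<And>x. \<bar>q x\<bar> \<le> B" using torus_fun_bounded [OF torus_cont_fun [OF q]] by blast
  have "(\<lambda>M. \<integral>x. g x * (p (real M * x) * q (real j * (real M * x) + real l * x)) \<partial>circle) \<longlonglongrightarrow>
      (\<integral>x. g x * (\<integral>s. p s * q (real j * s + real l * x) \<partial>circle) \<partial>circle)"
  proof (rule oscillation_limit [OF _ _ _ g, where C = "A * B"])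
    have "continuous_on UNIV (\<lambda>z. p (fst z))"
      by (rule continuous_on_compose2 [OF pc]) (auto intro: continuous_on_fst continuous_on_id)
    moreover have "continuous_on UNIV (\<lambda>z. q (real j * fst z + real l * snd z))"
      by (rule continuous_on_compose2 [OF qc])
        (auto intro!: continuous_on_add continuous_on_mult continuous_on_const continuous_on_fst continuous_on_snd continuous_on_id)
    ultimately show "continuous_on UNIV (\<lambda>(s, x). p s * q (real j * s + real l * x))"
      unfolding case_prod_beta by (rule continuous_on_mult)
    show "(\<lambda>x. p (s + real k) * q (real j * (s + real k) + real l * x)) = (\<lambda>x. p s * q (real j * s + real l * x))" for s k
    proof
      fix x
      have e: "real j * (s + real k) + real l * x = (real j * s + real l * x) + real (j * k)"
        by (simp add: algebra_simps)
      show "p (s + real k) * q (real j * (s + real k) + real l * x) = p s * q (real j * s + real l * x)"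
        unfolding e periodic_add_nat [OF pp] periodic_add_nat [OF qp] by (rule refl)
    qed
    show "\<bar>p s * q (real j * s + real l * x)\<bar> \<le> A * B" for s x
      using A B by (simp add: abs_mult mult_mono')
  qed
  moreover have "real j * (real M * x) + real l * x = real (j * M + l) * x" for M x
    by (simp add: algebra_simps)
  ultimately show ?thesis by (simp only:)
qed

lemma torus_fun_convolution:
  assumes p: "torus_fun p" and g: "torus_fun g"
  shows "torus_fun (\<lambda>y. \<integral>s. p s * g (y - s) \<partial>circle)"
proof -
  have pm [measurable]: "p \<in> borel_measurable borel" using p by (rule torus_fun_measurable)
  have gm [measurable]: "g \<in> borel_measurable borel" using g by (rule torus_fun_measurable)
  obtain A where A: "\<And>x. \<bar>p x\<bar> \<le> A" using torus_fun_bounded [OF p] by blast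
  obtain B where B: "\<And>x. \<bar>g x\<bar> \<le> B" using torus_fun_bounded [OF g] by blast
  have "(\<lambda>y. \<integral>s. p s * g (y - s) \<partial>circle) \<in> borel_measurable borel" by measurable
  moreover have "\<bar>\<integral>s. p s * g (y - s) \<partial>circle\<bar> \<le> A * B" for y
    by (rule abs_integral_circle_le) (use A B in \<open>auto simp: abs_mult mult_mono'\<close>)
  moreover have "periodic (\<lambda>y. \<integral>s. p s * g (y - s) \<partial>circle)"
    unfolding periodic_def
  proof
    fix y :: real
    have e: "y + 1 - s = (y - s) + 1" for s :: real by simp
    have "periodic g" using g by (simp add: torus_fun_def)
    then show "(\<integral>s. p s * g (y + 1 - s) \<partial>circle) = (\<integral>s. p s * g (y - s) \<partial>circle)"
      unfolding e by (simp only: periodicD [OF \<open>periodic g\<close>])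
  qed
  ultimately show ?thesis unfolding torus_fun_def by (intro conjI exI [of _ "A * B"] allI)
qed

lemma correlation_swap:
  assumes p: "torus_fun p" and q: "torus_fun q" and g: "torus_fun g"
  shows "(\<integral>x. g x * (\<integral>s. p s * q (a * s + x) \<partial>circle) \<partial>circle) = (\<integral>s. (\<integral>x. g x * q (x + a * s) \<partial>circle) * p s \<partial>circle)"
proof -
  have pm [measurable]: "p \<in> borel_measurable borel" using p by (rule torus_fun_measurable)
  have qm [measurable]: "q \<in> borel_measurable borel" using q by (rule torus_fun_measurable)
  have gm [measurable]: "g \<in> borel_measurable borel" using g by (rule torus_fun_measurable)
  obtain A where A: "\<And>x. \<bar>p x\<bar> \<le> A" using torus_fun_bounded [OF p] by blast
  obtain B where B: "\<And>x. \<bar>q x\<bar> \<le> B" using torus_fun_bounded [OF q] by blast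
  obtain C where C: "\<And>x. \<bar>g x\<bar> \<le> C" using torus_fun_bounded [OF g] by blast
  have fin: "finite_measure (circle \<Otimes>\<^sub>M circle)"
    by (intro finite_measure_pair_measure circle.finite_measure_axioms)
  have bound: "\<bar>g x * p s * q y\<bar> \<le> C * A * B" for x s y
    unfolding abs_mult by (intro mult_mono A B C mult_nonneg_nonneg) (use A [of 0] C [of 0] in auto)
  have int1: "integrable (circle \<Otimes>\<^sub>M circle) (\<lambda>(x,s). g x * (p s * q (a * s + x)))"
    by (rule finite_measure.integrable_const_bound [OF fin, where B = "C * A * B"])
       (use bound in \<open>auto simp: mult.assoc\<close>)
  have "(\<integral>x. g x * (\<integral>s. p s * q (a * s + x) \<partial>circle) \<partial>circle) = (\<integral>x. (\<integral>s. g x * (p s * q (a * s + x)) \<partial>circle) \<partial>circle)"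
    by simp
  also have "\<dots> = (\<integral>s. (\<integral>x. g x * (p s * q (a * s + x)) \<partial>circle) \<partial>circle)"
    by (rule circle2.Fubini_integral [OF int1, symmetric])
  also have "\<dots> = (\<integral>s. (\<integral>x. g x * q (x + a * s) \<partial>circle) * p s \<partial>circle)"
    by (subst integral_mult_left_zero [symmetric]) (simp add: mult_ac add.commute)
  finally show ?thesis .
qed

text \<open>
  Substituting \<open>y = x + s\<close> turns integration against \<open>p\<close> into integration against \<open>q\<close>. With
  \<open>correlation_swap\<close> this lets either factor of a correlation be isolated against a test function.
\<close>

lemma correlation_dual:
  assumes p: "torus_fun p" and q: "torus_fun q" and g: "torus_fun g"
  shows "(\<integral>s. (\<integral>x. g x * q (x + s) \<partial>circle) * p s \<partial>circle) = (\<integral>y. (\<integral>s. p s * g (y - s) \<partial>circle) * q y \<partial>circle)"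
proof -
  have pm [measurable]: "p \<in> borel_measurable borel" using p by (rule torus_fun_measurable)
  have qm [measurable]: "q \<in> borel_measurable borel" using q by (rule torus_fun_measurable)
  have gm [measurable]: "g \<in> borel_measurable borel" using g by (rule torus_fun_measurable)
  obtain A where A: "\<And>x. \<bar>p x\<bar> \<le> A" using torus_fun_bounded [OF p] by blast
  obtain B where B: "\<And>x. \<bar>q x\<bar> \<le> B" using torus_fun_bounded [OF q] by blast
  obtain C where C: "\<And>x. \<bar>g x\<bar> \<le> C" using torus_fun_bounded [OF g] by blast
  have fin: "finite_measure (circle \<Otimes>\<^sub>M circle)"
    by (intro finite_measure_pair_measure circle.finite_measure_axioms)
  have bound: "\<bar>g x * p s * q y\<bar> \<le> C * A * B" for x s y
    unfolding abs_mult by (intro mult_mono A B C mult_nonneg_nonneg) (use A [of 0] C [of 0] in auto)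
  have bound2: "\<bar>p s * (g x * q y)\<bar> \<le> C * A * B" for x s y
    using bound [of x s y] by (simp add: mult_ac)
  have int: "integrable (circle \<Otimes>\<^sub>M circle) (\<lambda>(y,s). p s * (g (y - s) * q y))"
    by (rule finite_measure.integrable_const_bound [OF fin, where B = "C * A * B"])
       (use bound2 in auto)
  have "(\<integral>x. g x * q (x + s) \<partial>circle) = (\<integral>y. g (y - s) * q y \<partial>circle)" for s
  proof -
    have t: "torus_fun (\<lambda>y. g (y - s) * q y)"
      using torus_fun_mult [OF torus_fun_compose_affine [OF g, of 1 "-s"] q] by simp
    show ?thesis using integral_circle_shift [OF t, of s] by simp
  qed
  then have "(\<integral>s. (\<integral>x. g x * q (x + s) \<partial>circle) * p s \<partial>circle) = (\<integral>s. (\<integral>y. p s * (g (y - s) * q y) \<partial>circle) \<partial>circle)"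
    by (simp add: mult.commute)
  also have "\<dots> = (\<integral>y. (\<integral>s. p s * (g (y - s) * q y) \<partial>circle) \<partial>circle)"
    by (rule circle2.Fubini_integral [OF int])
  also have "\<dots> = (\<integral>y. (\<integral>s. p s * g (y - s) \<partial>circle) * q y \<partial>circle)"
    by (subst integral_mult_left_zero [symmetric]) (simp add: mult_ac)
  finally show "(\<integral>s. (\<integral>x. g x * q (x + s) \<partial>circle) * p s \<partial>circle) = \<dots>" .
qed

lemma eventually_tests:
  fixes F :: "(real \<Rightarrow> real) \<Rightarrow> nat \<Rightarrow> real"
  assumes "finite T" "\<And>g. g \<in> T \<Longrightarrow> F g \<longlonglongrightarrow> L g" "e > 0"
  obtains M where "M \<ge> (m::nat)" "\<And>g. g \<in> T \<Longrightarrow> \<bar>F g M - L g\<bar> < e"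
proof -
  have "\<forall>\<^sub>F M in sequentially. \<forall>g\<in>T. \<bar>F g M - L g\<bar> < e"
  proof (rule eventually_ball_finite [OF assms(1)], rule ballI)
    fix g assume "g \<in> T"
    then show "\<forall>\<^sub>F M in sequentially. \<bar>F g M - L g\<bar> < e"
      using tendstoD [OF assms(2) assms(3)] by (simp add: dist_real_def)
  qed
  then have "\<forall>\<^sub>F M in sequentially. M \<ge> m \<and> (\<forall>g\<in>T. \<bar>F g M - L g\<bar> < e)"
    by (intro eventually_conj eventually_ge_at_top)
  then obtain M where "M \<ge> m \<and> (\<forall>g\<in>T. \<bar>F g M - L g\<bar> < e)"
    by (auto dest: eventually_happens)
  then show ?thesis using that by blast
qed

text \<open>
  The idempotents are \<open>f\<^sub>1 (M x) f\<^sub>2 ((M + 1) x)\<close>. For large \<open>M\<close> their modulus averages to the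
  correlation of \<open>\<bar>f\<^sub>1\<bar>\<close> and \<open>\<bar>f\<^sub>2\<bar>\<close>, and the two factors are replaced by \<open>v\<close> and \<open>w\<close> one after the
  other.
\<close>

lemma attainable_correlation:
  assumes v: "attainable v" and w: "attainable w"
  shows "attainable (\<lambda>x. \<integral>s. v s * w (s + x) \<partial>circle)"
proof (rule attainableI)
  note vc = attainable_cont [OF v] and wc = attainable_cont [OF w]
  note vf = torus_cont_fun [OF vc] and wf = torus_cont_fun [OF wc]
  show "torus_cont (\<lambda>x. \<integral>s. v s * w (s + x) \<partial>circle)" by (rule torus_cont_correlation [OF vf wc])
  fix T :: "(real \<Rightarrow> real) set" and N :: nat and e :: real
  assume T: "finite T" "\<forall>g\<in>T. torus_fun g" "e > 0"
  note swap1 = correlation_swap [where a = 1, unfolded mult_1]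
  define T1 where "T1 = (\<lambda>g s. \<integral>x. g x * w (x + s) \<partial>circle) ` T"
  have T1: "finite T1" "\<And>f. f \<in> T1 \<Longrightarrow> torus_fun f"
    unfolding T1_def using T torus_cont_correlation [OF _ wc] torus_cont_fun by auto
  have e3: "e / 3 > 0" using T by simp
  obtain H c where H: "finite H" "H \<noteq> {}" "spread (N + 1) H" "c > 0"
    and a: "\<And>f. f \<in> T1 \<Longrightarrow> \<bar>c * (\<integral>x. f x * abs_idem H x \<partial>circle) - (\<integral>x. f x * v x \<partial>circle)\<bar> < e / 3"
    using attainableE [OF v T1 e3, where N = "N + 1"] by blast
  note Hc = torus_cont_abs_idem [of H]
  note Hf = torus_cont_fun [OF Hc]
  \<comment> \<open>The tests for \<open>w\<close> involve the idempotent just chosen for \<open>v\<close>.\<close>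
  define T2 where "T2 = (\<lambda>g y. \<integral>s. (c * abs_idem H s) * g (y - s) \<partial>circle) ` T"
  have T2: "finite T2" "\<And>f. f \<in> T2 \<Longrightarrow> torus_fun f"
    unfolding T2_def using T torus_fun_convolution [OF torus_fun_cmult [OF Hf]] by auto
  obtain K d where K: "finite K" "K \<noteq> {}" "spread (N + 1) K" "d > 0"
    and b: "\<And>f. f \<in> T2 \<Longrightarrow> \<bar>d * (\<integral>x. f x * abs_idem K x \<partial>circle) - (\<integral>x. f x * w x \<partial>circle)\<bar> < e / 3"
    using attainableE [OF w T2 e3, where N = "N + 1"] by blast
  note Kc = torus_cont_abs_idem [of K]
  note Kf = torus_cont_fun [OF Kc]
  define m where "m = Max K"
  have m: "k \<le> m" if "k \<in> K" for k using K that by (simp add: m_def)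
  have e4: "e / 3 / (c * d) > 0" using e3 H K by simp
  have lim: "(\<lambda>M. \<integral>x. g x * (abs_idem H (real M * x) * abs_idem K (real (1 * M + 1) * x)) \<partial>circle) \<longlonglongrightarrow>
      (\<integral>x. g x * (\<integral>s. abs_idem H s * abs_idem K (real 1 * s + real 1 * x) \<partial>circle) \<partial>circle)" if "g \<in> T" for g
    using that T by (intro oscillation_limit_product Hc Kc) blast
  obtain M where M: "M \<ge> m + (N + 1)"
    and l: "\<And>g. g \<in> T \<Longrightarrow> \<bar>(\<integral>x. g x * (abs_idem H (real M * x) * abs_idem K (real (1 * M + 1) * x)) \<partial>circle) -
        (\<integral>x. g x * (\<integral>s. abs_idem H s * abs_idem K (real 1 * s + real 1 * x) \<partial>circle) \<partial>circle)\<bar> < e / 3 / (c * d)"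
    using eventually_tests [where F = "\<lambda>g M. \<integral>x. g x * (abs_idem H (real M * x) * abs_idem K (real (1 * M + 1) * x)) \<partial>circle"
        and L = "\<lambda>g. \<integral>x. g x * (\<integral>s. abs_idem H s * abs_idem K (real 1 * s + real 1 * x) \<partial>circle) \<partial>circle",
        OF T(1) lim e4, where m = "m + (N + 1)"] by blast
  let ?L = "(\<lambda>(h,k). M * h + (M + 1) * k) ` (H \<times> K)"
  have inj: "inj_on (\<lambda>(h,k). M * h + (M + 1) * k) (H \<times> K)" and sp: "spread (N + 1) ?L"
    using spread_skew_sumset [of K m "N + 1" H M] m H K M by auto
  have "\<bar>c * d * (\<integral>x. g x * abs_idem ?L x \<partial>circle) - (\<integral>x. g x * (\<integral>s. v s * w (s + x) \<partial>circle) \<partial>circle)\<bar> < e"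
    if g: "g \<in> T" for g
  proof -
    have gt: "torus_fun g" using g T by blast
    define X where "X = (\<integral>x. g x * (\<integral>s. v s * w (s + x) \<partial>circle) \<partial>circle)"
    define Y where "Y = (\<integral>x. g x * (\<integral>s. abs_idem H s * w (s + x) \<partial>circle) \<partial>circle)"
    define Z where "Z = (\<integral>x. g x * (\<integral>s. abs_idem H s * abs_idem K (s + x) \<partial>circle) \<partial>circle)"
    have "\<bar>c * Y - X\<bar> < e / 3"
      using a [of "\<lambda>s. \<integral>x. g x * w (x + s) \<partial>circle"] g
      unfolding X_def Y_def swap1 [OF vf wf gt] swap1 [OF Hf wf gt]
      by (simp add: T1_def)
    moreover have "\<bar>c * d * Z - c * Y\<bar> < e / 3"
    proof -
      have A1: "\<bar>d * (\<integral>y. (\<integral>s. (c * abs_idem H s) * g (y - s) \<partial>circle) * abs_idem K y \<partial>circle) -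
          (\<integral>y. (\<integral>s. (c * abs_idem H s) * g (y - s) \<partial>circle) * w y \<partial>circle)\<bar> < e / 3"
        using b g unfolding T2_def by blast
      have A2: "(\<integral>y. (\<integral>s. (c * abs_idem H s) * g (y - s) \<partial>circle) * q y \<partial>circle) =
          c * (\<integral>x. g x * (\<integral>s. abs_idem H s * q (s + x) \<partial>circle) \<partial>circle)" if "torus_fun q" for q
        unfolding swap1 [OF Hf that gt] correlation_dual [OF Hf that gt]
        by (simp add: mult.assoc)
      show ?thesis
        using A1 unfolding A2 [OF wf] A2 [OF Kf] Y_def Z_def by (simp add: mult_ac)
    qed
    moreover have "\<bar>c * d * (\<integral>x. g x * abs_idem ?L x \<partial>circle) - c * d * Z\<bar> < e / 3"
    proof -
      have cd: "c * d > 0" using H K by simp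
      have "\<bar>(\<integral>x. g x * abs_idem ?L x \<partial>circle) - Z\<bar> < e / 3 / (c * d)"
        using l [OF g] unfolding abs_idem_image [OF inj] Z_def by simp
      then have "c * d * \<bar>(\<integral>x. g x * abs_idem ?L x \<partial>circle) - Z\<bar> < e / 3"
        using cd by (simp add: pos_less_divide_eq mult.commute)
      moreover have "\<bar>c * d * u - c * d * z\<bar> = c * d * \<bar>u - z\<bar>" for u z
        using cd by (simp only: right_diff_distrib [symmetric] abs_mult [of "c * d"] abs_of_pos)
      ultimately show ?thesis by (simp only:)
    qed
    ultimately show ?thesis unfolding X_def [symmetric] by linarith
  qed
  then show "\<exists>H c. finite H \<and> H \<noteq> {} \<and> spread N H \<and> c > 0 \<and>
      (\<forall>g\<in>T. \<bar>c * (\<integral>x. g x * abs_idem H x \<partial>circle) - (\<integral>x. g x * (\<integral>s. v s * w (s + x) \<partial>circle) \<partial>circle)\<bar> < e)"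
    using H K sp spread_mono [OF sp, of N] by (intro exI [of _ ?L] exI [of _ "c * d"]) auto
qed

section \<open>The starting weight\<close>

definition dirichlet2 :: "real \<Rightarrow> real" where
  "dirichlet2 = abs_idem {0, 1}"

lemma torus_cont_dirichlet2: "torus_cont dirichlet2"
  by (simp add: dirichlet2_def torus_cont_abs_idem)

text \<open>
  The idempotents are \<open>(1 + e (M x)) (1 + e ((2 M + m) x))\<close>, with frequencies
  \<open>0, M, 2 M + m, 3 M + m\<close>.
\<close>

lemma attainable_base:
  assumes m: "m > 0"
  shows "attainable (\<lambda>x. \<integral>s. dirichlet2 s * dirichlet2 (2 * s + real m * x) \<partial>circle)"
proof (rule attainableI)
  note D = torus_cont_dirichlet2
  show "torus_cont (\<lambda>x. \<integral>s. dirichlet2 s * dirichlet2 (2 * s + real m * x) \<partial>circle)"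
    using torus_cont_integral_param [OF torus_cont_fun [OF D] D, of 2 m] by simp
  fix T :: "(real \<Rightarrow> real) set" and N :: nat and e :: real
  assume T: "finite T" "\<forall>g\<in>T. torus_fun g" "e > 0"
  have lim: "(\<lambda>M. \<integral>x. g x * (dirichlet2 (real M * x) * dirichlet2 (real (2 * M + m) * x)) \<partial>circle) \<longlonglongrightarrow>
      (\<integral>x. g x * (\<integral>s. dirichlet2 s * dirichlet2 (real 2 * s + real m * x) \<partial>circle) \<partial>circle)" if "g \<in> T" for g
    using that T by (intro oscillation_limit_product D) blast
  obtain M where M: "M \<ge> N + 1"
    and l: "\<And>g. g \<in> T \<Longrightarrow> \<bar>(\<integral>x. g x * (dirichlet2 (real M * x) * dirichlet2 (real (2 * M + m) * x)) \<partial>circle) -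
        (\<integral>x. g x * (\<integral>s. dirichlet2 s * dirichlet2 (real 2 * s + real m * x) \<partial>circle) \<partial>circle)\<bar> < e"
    using eventually_tests [where F = "\<lambda>g M. \<integral>x. g x * (dirichlet2 (real M * x) * dirichlet2 (real (2 * M + m) * x)) \<partial>circle"
        and L = "\<lambda>g. \<integral>x. g x * (\<integral>s. dirichlet2 s * dirichlet2 (real 2 * s + real m * x) \<partial>circle) \<partial>circle",
        OF T(1) lim T(3), where m = "N + 1"] by blast
  let ?f = "\<lambda>(h,k). M * h + (2 * M + m) * k"
  let ?L = "?f ` ({0,1} \<times> {0,1})"
  have inj: "inj_on ?f ({0,1} \<times> {0,1})" using M m by (auto simp: inj_on_def)
  have sp: "spread N ?L" using M by (auto simp: spread_def)
  have "abs_idem ?L x = dirichlet2 (real M * x) * dirichlet2 (real (2 * M + m) * x)" for x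
    unfolding dirichlet2_def by (rule abs_idem_image [OF inj])
  then have "\<forall>g\<in>T. \<bar>1 * (\<integral>x. g x * abs_idem ?L x \<partial>circle) -
      (\<integral>x. g x * (\<integral>s. dirichlet2 s * dirichlet2 (2 * s + real m * x) \<partial>circle) \<partial>circle)\<bar> < e"
    using l by simp
  then show "\<exists>H c. finite H \<and> H \<noteq> {} \<and> spread N H \<and> c > 0 \<and>
      (\<forall>g\<in>T. \<bar>c * (\<integral>x. g x * abs_idem H x \<partial>circle) -
        (\<integral>x. g x * (\<integral>s. dirichlet2 s * dirichlet2 (2 * s + real m * x) \<partial>circle) \<partial>circle)\<bar> < e)"
    using sp by (intro exI [of _ ?L] exI [of _ "1::real"] conjI) auto
qed

lemma torus_cont_cos: "torus_cont (\<lambda>x. cos (2 * pi * (real m * x + t)))"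
proof -
  have "cos (2 * pi * (x + 1)) = cos (2 * pi * x)" for x
    using cos_periodic [of "2 * pi * x"] by (simp add: algebra_simps)
  then have "torus_cont (\<lambda>x. cos (2 * pi * x))"
    by (simp add: torus_cont_def periodic_def) (intro continuous_intros)
  from torus_cont_compose_affine [OF this, of m t] show ?thesis .
qed

lemma torus_cont_sin: "torus_cont (\<lambda>x. sin (2 * pi * (real m * x + t)))"
proof -
  have "sin (2 * pi * (x + 1)) = sin (2 * pi * x)" for x
    using sin_periodic [of "2 * pi * x"] by (simp add: algebra_simps)
  then have "torus_cont (\<lambda>x. sin (2 * pi * x))"
    by (simp add: torus_cont_def periodic_def) (intro continuous_intros)
  from torus_cont_compose_affine [OF this, of m t] show ?thesis .
qed

lemma integral_cos:
  assumes m: "m > 0"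
  shows "(\<integral>s. cos (2 * pi * (real m * s + t)) \<partial>circle) = 0"
proof -
  let ?F = "\<lambda>s. sin (2 * pi * (real m * s + t)) / (2 * pi * real m)"
  have "(\<integral>s. cos (2 * pi * (real m * s + t)) \<partial>circle) = ?F 1 - ?F 0"
  proof (rule integral_circle_FTC)
    show "(?F has_real_derivative cos (2 * pi * (real m * x + t))) (at x)" for x
      using m by (auto intro!: derivative_eq_intros simp: field_simps)
  qed (intro continuous_intros)
  also have "sin (2 * pi * (real m * 1 + t)) = sin (2 * pi * (real m * 0 + t))"
    using periodic_add_nat [of "\<lambda>x. sin (2 * pi * (real 1 * x + t))" 0 m] torus_cont_sin [of 1 t]
    by (simp add: torus_cont_def)
  finally show ?thesis by simp
qed

lemma dirichlet2_sq: "(dirichlet2 s)\<^sup>2 = 2 + 2 * cos (2 * pi * s)"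
proof -
  have "idempotent_of {0, 1} s = 1 + cis (2 * pi * s)"
    by (simp add: idempotent_of_def character_cis)
  then have "(dirichlet2 s)\<^sup>2 = (1 + cos (2 * pi * s))\<^sup>2 + (sin (2 * pi * s))\<^sup>2"
    by (simp add: dirichlet2_def abs_idem_def cmod_power2)
  also have "\<dots> = 1 + 2 * cos (2 * pi * s) + ((sin (2 * pi * s))\<^sup>2 + (cos (2 * pi * s))\<^sup>2)"
    by (simp add: power2_eq_square algebra_simps)
  finally show ?thesis by simp
qed

text \<open>
  The half-period shift removes the modulus on \<open>[0, 1]\<close>.
\<close>

lemma dirichlet2_half: assumes "s \<in> {0..1}" shows "dirichlet2 (s + 1/2) = 2 * sin (pi * s)"
proof -
  have "(dirichlet2 (s + 1/2))\<^sup>2 = (2 * sin (pi * s))\<^sup>2"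
  proof -
    have "cos (2 * pi * (s + 1/2)) = - cos (2 * (pi * s))"
      using cos_add [of "2 * (pi * s)" pi] by (simp add: algebra_simps)
    then show ?thesis unfolding dirichlet2_sq by (simp add: cos_double_sin power2_eq_square)
  qed
  moreover have "sin (pi * s) \<ge> 0" using assms by (intro sin_ge_zero) (auto simp: mult_le_cancel_left1)
  ultimately show ?thesis
    by (subst (asm) power2_eq_iff_nonneg) (auto simp: dirichlet2_def abs_idem_nonneg)
qed

text \<open>
  The phase \<open>t\<close> covers the cosine and the sine coefficient in one formula; the sine coefficients
  vanish because \<open>\<bar>1 + e\<bar>\<close> is even.
\<close>

lemma dirichlet2_fourier:
  "(\<integral>s. dirichlet2 s * cos (2 * pi * (real k * s + t)) \<partial>circle) =
     cos (2 * pi * t) * (-1) ^ (k + 1) * (4 / pi) / (4 * (real k)\<^sup>2 - 1)"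
proof -
  have odd1: "2 * real k + 1 \<noteq> 0" by linarith
  have odd2: "2 * real k - 1 \<noteq> 0"
  proof (cases k)
    case (Suc n) then show ?thesis by (simp add: algebra_simps)
  qed simp
  have t1: "torus_fun (\<lambda>s. dirichlet2 s * cos (2 * pi * (real k * s + t)))"
    by (intro torus_cont_fun torus_cont_mult torus_cont_dirichlet2 torus_cont_cos)
  let ?sg = "(-1::real) ^ k"
  have sh: "cos (2 * pi * (real k * (s + 1/2) + t)) = ?sg * cos (2 * pi * (real k * s + t))" for s
  proof -
    have "2 * pi * (real k * (s + 1/2) + t) = 2 * pi * (real k * s + t) + real k * pi"
      by (simp add: algebra_simps)
    then show ?thesis using cos_npi [of k] sin_npi [of k] by (simp only: cos_add) simp
  qed
  have "(\<integral>s. dirichlet2 s * cos (2 * pi * (real k * s + t)) \<partial>circle) =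
      (\<integral>s. dirichlet2 (s + 1/2) * cos (2 * pi * (real k * (s + 1/2) + t)) \<partial>circle)"
    by (rule integral_circle_shift [OF t1, symmetric])
  also have "\<dots> = (\<integral>s. ?sg * (sin ((2 * real k + 1) * pi * s + 2 * pi * t) - sin ((2 * real k - 1) * pi * s + 2 * pi * t)) \<partial>circle)"
  proof (rule integral_circle_cong)
    fix s :: real assume "s \<in> {0..<1}"
    then have d: "dirichlet2 (s + 1/2) = 2 * sin (pi * s)" by (intro dirichlet2_half) auto
    have "sin ((2 * real k + 1) * pi * s + 2 * pi * t) - sin ((2 * real k - 1) * pi * s + 2 * pi * t)
        = sin (2 * pi * (real k * s + t) + pi * s) - sin (2 * pi * (real k * s + t) - pi * s)"
      by (simp add: algebra_simps)
    also have "\<dots> = 2 * sin (pi * s) * cos (2 * pi * (real k * s + t))"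
      by (simp add: sin_add sin_diff)
    finally show "dirichlet2 (s + 1/2) * cos (2 * pi * (real k * (s + 1/2) + t)) =
        ?sg * (sin ((2 * real k + 1) * pi * s + 2 * pi * t) - sin ((2 * real k - 1) * pi * s + 2 * pi * t))"
      unfolding sh d by simp
  next
    show "(\<lambda>s. dirichlet2 (s + 1/2) * cos (2 * pi * (real k * (s + 1/2) + t))) \<in> borel_measurable borel"
      using torus_fun_measurable [OF torus_fun_compose_affine [OF t1, of 1 "1/2"]] by simp
  qed simp
  also have "\<dots> = ?sg * (\<integral>s. sin ((2 * real k + 1) * pi * s + 2 * pi * t) - sin ((2 * real k - 1) * pi * s + 2 * pi * t) \<partial>circle)"
    by simp
  also have "(\<integral>s. sin ((2 * real k + 1) * pi * s + 2 * pi * t) - sin ((2 * real k - 1) * pi * s + 2 * pi * t) \<partial>circle) =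
      (- cos ((2 * real k + 1) * pi * 1 + 2 * pi * t) / ((2 * real k + 1) * pi) + cos ((2 * real k - 1) * pi * 1 + 2 * pi * t) / ((2 * real k - 1) * pi))
      - (- cos ((2 * real k + 1) * pi * 0 + 2 * pi * t) / ((2 * real k + 1) * pi) + cos ((2 * real k - 1) * pi * 0 + 2 * pi * t) / ((2 * real k - 1) * pi))"
  proof (rule integral_circle_FTC)
    show "((\<lambda>s. - cos ((2 * real k + 1) * pi * s + 2 * pi * t) / ((2 * real k + 1) * pi) + cos ((2 * real k - 1) * pi * s + 2 * pi * t) / ((2 * real k - 1) * pi))
       has_real_derivative sin ((2 * real k + 1) * pi * x + 2 * pi * t) - sin ((2 * real k - 1) * pi * x + 2 * pi * t)) (at x)" for x
      using odd1 odd2 by (auto intro!: derivative_eq_intros)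
  qed (intro continuous_intros)
  also have "cos ((2 * real k + 1) * pi * 1 + 2 * pi * t) = - cos (2 * pi * t)"
  proof -
    have "(2 * real k + 1) * pi * 1 + 2 * pi * t = 2 * pi * t + real (2 * k + 1) * pi" by (simp add: algebra_simps)
    then show ?thesis using cos_npi [of "2 * k + 1"] sin_npi [of "2 * k + 1"] by (simp only: cos_add) simp
  qed
  also have "cos ((2 * real k - 1) * pi * 1 + 2 * pi * t) = - cos (2 * pi * t)"
  proof -
    have "(2 * real k - 1) * pi * 1 + 2 * pi * t = 2 * pi * t + real (2 * k) * pi - pi" by (simp add: algebra_simps)
    then show ?thesis using cos_npi [of "2 * k"] sin_npi [of "2 * k"] by (simp only: cos_diff cos_add) simp
  qed
  finally have "(\<integral>s. dirichlet2 s * cos (2 * pi * (real k * s + t)) \<partial>circle) =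
     ?sg * cos (2 * pi * t) * (2 / ((2 * real k + 1) * pi) - 2 / ((2 * real k - 1) * pi))"
    by (simp add: algebra_simps)
  also have "2 / ((2 * real k + 1) * pi) - 2 / ((2 * real k - 1) * pi) = - ((4 / pi) / (4 * (real k)\<^sup>2 - 1))"
  proof -
    have "4 * (real k)\<^sup>2 - 1 = (2 * real k + 1) * (2 * real k - 1)" by (simp add: power2_eq_square algebra_simps)
    moreover have "2 / (u * pi) - 2 / (w * pi) = - ((2 * (u - w) / pi) / (u * w))" if "u \<noteq> 0" "w \<noteq> 0" for u w :: real
      using that by (simp add: field_simps)
    from this [OF odd1 odd2]
    have "2 / ((2 * real k + 1) * pi) - 2 / ((2 * real k - 1) * pi) = - ((4 / pi) / ((2 * real k + 1) * (2 * real k - 1)))"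
      by simp
    ultimately show ?thesis by simp
  qed
  finally show ?thesis by simp
qed

section \<open>Waves and their correlations\<close>

text \<open>
  Constant term 1 and \<open>m\<close>-th Fourier coefficient \<open>b\<close>, up to a remainder bounded by \<open>r\<close> that is
  orthogonal to constants and, since \<open>t\<close> is arbitrary, to both the cosine and the sine of frequency \<open>m\<close>.
\<close>

definition wave :: "nat \<Rightarrow> real \<Rightarrow> real \<Rightarrow> (real \<Rightarrow> real) \<Rightarrow> bool" where
  "wave m b r K \<longleftrightarrow> (\<exists>v. torus_cont v \<and> (\<forall>x. \<bar>v x\<bar> \<le> r) \<and> integral\<^sup>L circle v = 0 \<and>
     (\<forall>t. (\<integral>s. v s * cos (2 * pi * (real m * s + t)) \<partial>circle) = 0) \<and>
     K = (\<lambda>x. 1 + 2 * b * cos (2 * pi * (real m * x)) + v x))"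

lemma has_integral_torus_fun: "torus_fun f \<Longrightarrow> has_bochner_integral circle f (integral\<^sup>L circle f)"
  by (rule has_bochner_integral_integrable [OF torus_fun_integrable])

lemma has_integral_torus_funI:
  "torus_fun f \<Longrightarrow> integral\<^sup>L circle f = c \<Longrightarrow> has_bochner_integral circle f c"
  using has_integral_torus_fun by blast

lemma integral_cos_cos:
  assumes m: "m > 0"
  shows "(\<integral>s. cos (2 * pi * (real m * s + t)) * cos (2 * pi * (real m * s + u)) \<partial>circle) = cos (2 * pi * (t - u)) / 2"
proof -
  have "cos (2 * pi * (real m * s + t)) * cos (2 * pi * (real m * s + u)) =
      cos (2 * pi * (t - u)) / 2 + cos (2 * pi * (real (2 * m) * s + (t + u))) / 2" for s
  proof -
    have e1: "2 * pi * (t - u) = 2 * pi * (real m * s + t) - 2 * pi * (real m * s + u)"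
      and e2: "2 * pi * (real (2 * m) * s + (t + u)) = 2 * pi * (real m * s + t) + 2 * pi * (real m * s + u)"
      by (simp_all add: algebra_simps)
    have "X = (X + Y) / 2 + (X - Y) / 2" for X Y :: real by (simp add: field_simps)
    then show ?thesis unfolding e1 e2 cos_add cos_diff .
  qed
  moreover have "(\<integral>s. cos (2 * pi * (t - u)) / 2 + cos (2 * pi * (real (2 * m) * s + (t + u))) / 2 \<partial>circle) = cos (2 * pi * (t - u)) / 2"
    using integral_cos [of "2 * m" "t + u"] m torus_fun_integrable [OF torus_cont_fun [OF torus_cont_cos [of "2 * m" "t + u"]]]
    by (subst Bochner_Integration.integral_add) auto
  ultimately show ?thesis by simp
qed

text \<open>
  Orthogonality annihilates every mixed term, so the coefficients and the bounds for the remainders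
  multiply.
\<close>

lemma wave_correlation:
  assumes m: "m > 0" and K: "wave m b r K" and L: "wave m c q L"
  shows "wave m (b * c) (r * q) (\<lambda>x. \<integral>s. K s * L (s + x) \<partial>circle)"
proof -
  let ?C = "\<lambda>x t. cos (2 * pi * (real m * x + t))"
  obtain v where vc: "torus_cont v" and vr: "\<And>x. \<bar>v x\<bar> \<le> r" and v0: "integral\<^sup>L circle v = 0"
    and vcos: "\<And>t. (\<integral>s. v s * ?C s t \<partial>circle) = 0" and Kv: "K = (\<lambda>x. 1 + 2 * b * cos (2 * pi * (real m * x)) + v x)"
    using K unfolding wave_def by blast
  obtain w where wc: "torus_cont w" and wq: "\<And>x. \<bar>w x\<bar> \<le> q" and w0: "integral\<^sup>L circle w = 0"
    and wcos: "\<And>t. (\<integral>s. w s * ?C s t \<partial>circle) = 0" and Lw: "L = (\<lambda>x. 1 + 2 * c * cos (2 * pi * (real m * x)) + w x)"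
    using L unfolding wave_def by blast
  note vf = torus_cont_fun [OF vc] and wf = torus_cont_fun [OF wc]
  have wsf: "torus_fun (\<lambda>s. w (s + x))" for x using torus_fun_compose_affine [OF wf, of 1 x] by simp
  note Cf = torus_cont_fun [OF torus_cont_cos]
  define z where "z x = (\<integral>s. v s * w (s + x) \<partial>circle)" for x
  have zc: "torus_cont z" unfolding z_def [abs_def] by (rule torus_cont_correlation [OF vf wc])
  have wsh: "(\<integral>s. w (s + x) * ?C s t \<partial>circle) = 0" for x t
  proof -
    have "torus_fun (\<lambda>s. w s * ?C s (t - real m * x))" by (intro torus_fun_mult wf Cf)
    from integral_circle_shift [OF this, of x]
    have "(\<integral>s. w (s + x) * ?C (s + x) (t - real m * x) \<partial>circle) = 0" using wcos by simp
    moreover have "real m * (s + x) + (t - real m * x) = real m * s + t" for s by (simp add: algebra_simps)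
    ultimately show ?thesis by (simp only:)
  qed
  have zr: "\<bar>z x\<bar> \<le> r * q" for x
    unfolding z_def
  proof (rule abs_integral_circle_le)
    show "(\<lambda>s. v s * w (s + x)) \<in> borel_measurable borel"
      by (rule torus_fun_measurable [OF torus_fun_mult [OF vf wsf]])
    show "\<bar>v s * w (s + x)\<bar> \<le> r * q" for s
      using vr wq by (simp add: abs_mult mult_mono')
  qed
  have z0: "integral\<^sup>L circle z = 0"
    using correlation_swap [where a = 1, unfolded mult_1, OF vf wf torus_cont_fun [OF torus_cont_const [of 1]]]
      integral_circle_shift [OF wf] w0 by (simp add: z_def [abs_def])
  have zcos: "(\<integral>x. z x * ?C x t \<partial>circle) = 0" for t
    using correlation_swap [where a = 1, unfolded mult_1, OF vf wf Cf [of m t]] wsh by (simp add: z_def [abs_def] mult.commute)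
  have eq: "(\<integral>s. K s * L (s + x) \<partial>circle) = 1 + 2 * (b * c) * cos (2 * pi * (real m * x)) + z x" for x
  proof -
    have "has_bochner_integral circle (\<lambda>s. 1 + 2 * b * ?C s 0 + v s + 2 * c * ?C s (real m * x) + w (s + x)
          + 4 * b * c * (?C s (real m * x) * ?C s 0) + 2 * b * (w (s + x) * ?C s 0) + 2 * c * (v s * ?C s (real m * x))
          + v s * w (s + x))
        (1 + 2 * b * 0 + 0 + 2 * c * 0 + 0 + 4 * b * c * (cos (2 * pi * (real m * x - 0)) / 2) + 2 * b * 0 + 2 * c * 0 + z x)"
    proof (intro has_bochner_integral_add has_bochner_integral_mult_right)
      show "has_bochner_integral circle (\<lambda>s. 1) (1::real)"
        using has_integral_torus_fun [OF torus_cont_fun [OF torus_cont_const [of 1]]] by simp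
      show "has_bochner_integral circle (\<lambda>s. ?C s 0) 0" "has_bochner_integral circle (\<lambda>s. ?C s (real m * x)) 0"
        using has_integral_torus_fun [OF Cf [of m]] integral_cos [OF m] by metis+
      show "has_bochner_integral circle v 0" using has_integral_torus_fun [OF vf] v0 by simp
      show "has_bochner_integral circle (\<lambda>s. w (s + x)) 0"
        using has_integral_torus_fun [OF wsf] integral_circle_shift [OF wf] w0 by metis
      show "has_bochner_integral circle (\<lambda>s. ?C s (real m * x) * ?C s 0) (cos (2 * pi * (real m * x - 0)) / 2)"
        using has_integral_torus_fun [OF torus_fun_mult [OF Cf [of m "real m * x"] Cf [of m 0]]] integral_cos_cos [OF m] by metis
      show "has_bochner_integral circle (\<lambda>s. w (s + x) * ?C s 0) 0"
        using has_integral_torus_fun [OF torus_fun_mult [OF wsf Cf [of m 0]]] wsh by metis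
      show "has_bochner_integral circle (\<lambda>s. v s * ?C s (real m * x)) 0"
        using has_integral_torus_fun [OF torus_fun_mult [OF vf Cf [of m "real m * x"]]] vcos by metis
      show "has_bochner_integral circle (\<lambda>s. v s * w (s + x)) (z x)"
        unfolding z_def by (rule has_integral_torus_fun [OF torus_fun_mult [OF vf wsf]])
    qed
    moreover have "1 + 2 * b * ?C s 0 + v s + 2 * c * ?C s (real m * x) + w (s + x)
          + 4 * b * c * (?C s (real m * x) * ?C s 0) + 2 * b * (w (s + x) * ?C s 0) + 2 * c * (v s * ?C s (real m * x))
          + v s * w (s + x) = K s * L (s + x)" for s
    proof -
      have e: "real m * (s + x) = real m * s + real m * x" by (rule distrib_left)
      show ?thesis unfolding Kv Lw e by (simp add: algebra_simps)
    qed
    ultimately have "has_bochner_integral circle (\<lambda>s. K s * L (s + x))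
        (1 + 2 * b * 0 + 0 + 2 * c * 0 + 0 + 4 * b * c * (cos (2 * pi * (real m * x - 0)) / 2) + 2 * b * 0 + 2 * c * 0 + z x)"
      by (simp only:)
    then show ?thesis by (simp add: has_bochner_integral_integral_eq)
  qed
  show ?thesis
    unfolding wave_def eq
    by (intro exI [of _ z] conjI allI zc zr z0 zcos refl)
qed

lemma wave_dilate:
  assumes K: "wave 1 b r K" and m: "m > 0"
  shows "wave m b r (\<lambda>x. K (real m * x))"
proof -
  obtain v where vc: "torus_cont v" and vr: "\<And>x. \<bar>v x\<bar> \<le> r" and v0: "integral\<^sup>L circle v = 0"
    and vcos: "\<And>t. (\<integral>s. v s * cos (2 * pi * (real 1 * s + t)) \<partial>circle) = 0"
    and Kv: "K = (\<lambda>x. 1 + 2 * b * cos (2 * pi * (real 1 * x)) + v x)"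
    using K unfolding wave_def by blast
  have "(\<integral>s. v (real m * s) * cos (2 * pi * (real m * s + t)) \<partial>circle) = 0" for t
    using integral_circle_dilate [OF torus_fun_mult [OF torus_cont_fun [OF vc] torus_cont_fun [OF torus_cont_cos [of 1 t]]] m] vcos [of t]
    by simp
  moreover have "(\<integral>s. v (real m * s) \<partial>circle) = 0"
    using integral_circle_dilate [OF torus_cont_fun [OF vc] m] v0 by simp
  moreover have "torus_cont (\<lambda>x. v (real m * x))"
    using torus_cont_compose_affine [OF vc, of m 0] by simp
  ultimately show ?thesis
    unfolding wave_def Kv using vr by (intro exI [of _ "\<lambda>x. v (real m * x)"] conjI allI) auto
qed

text \<open>
  Let \<open>a = \<bar>1 + e\<bar>\<close>, with mean \<open>A = 4/\<pi>\<close>. Remove from \<open>a\<close> its harmonics \<open>0, 1\<close> to get \<open>p\<close>, and its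
  harmonics \<open>0, 1, 2\<close> to get \<open>q\<close>. The function \<open>s \<mapsto> p (2 s + x)\<close> contains only harmonics of order
  at least 4, so in \<open>\<integral> a s * p (2 s + x) ds\<close> the factor \<open>a\<close> may be replaced by \<open>q\<close>. The remainder is
  therefore bounded by the \<open>L\<^sup>2\<close> norms of \<open>p\<close> and \<open>q\<close>, which follow from Parseval-type computations
  and a numerical bound for \<open>\<pi>\<close>.
\<close>

lemma wave_base: "\<exists>A>0. wave 1 (-1/45) (1/90) (\<lambda>x. (\<integral>s. dirichlet2 s * dirichlet2 (2 * s + x) \<partial>circle) / A)"
proof -
  define A where "A = 4 / pi"
  have A0: "A > 0" by (simp add: A_def)
  note Dc = torus_cont_dirichlet2
  note Df = torus_cont_fun [OF Dc]
  let ?C = "\<lambda>k x. cos (2 * pi * (real k * x + 0))"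
  note Cc = torus_cont_cos
  note Cf = torus_cont_fun [OF Cc]
  have D0: "(\<integral>s. dirichlet2 s \<partial>circle) = A"
    using dirichlet2_fourier [of 0 0] by (simp add: A_def)
  have D1: "(\<integral>s. dirichlet2 s * cos (2 * pi * (real 1 * s + t)) \<partial>circle) = A / 3 * cos (2 * pi * t)" for t
    unfolding dirichlet2_fourier by (simp add: A_def)
  have D2: "(\<integral>s. dirichlet2 s * cos (2 * pi * (real 2 * s + t)) \<partial>circle) = - A / 15 * cos (2 * pi * t)" for t
    unfolding dirichlet2_fourier by (simp add: A_def)
  have DD: "(\<integral>s. (dirichlet2 s)\<^sup>2 \<partial>circle) = 2"
    unfolding dirichlet2_sq
    using integral_cos [of 1 0] torus_fun_integrable [OF Cf [of 1 0]]
    by (subst Bochner_Integration.integral_add) auto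
  define p where "p y = dirichlet2 y - A - 2 / 3 * A * ?C 1 y" for y
  define q where "q y = dirichlet2 y - A - 2 / 3 * A * ?C 1 y + 2 / 15 * A * ?C 2 y" for y
  have pc: "torus_cont p"
  proof -
    have "torus_cont (\<lambda>y. (dirichlet2 y + (- A)) + (- (2 / 3 * A)) * ?C 1 y)"
      by (intro torus_cont_add torus_cont_mult Dc Cc torus_cont_const)
    then show ?thesis by (simp add: p_def [abs_def])
  qed
  have qc: "torus_cont q"
  proof -
    have "torus_cont (\<lambda>y. ((dirichlet2 y + (- A)) + (- (2 / 3 * A)) * ?C 1 y) + (2 / 15 * A) * ?C 2 y)"
      by (intro torus_cont_add torus_cont_mult Dc Cc torus_cont_const)
    then show ?thesis by (simp add: q_def [abs_def])
  qed
  note pf = torus_cont_fun [OF pc] and qf = torus_cont_fun [OF qc]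
  have p0: "integral\<^sup>L circle p = 0"
  proof -
    have "has_bochner_integral circle p (A - A - 2 / 3 * A * 0)"
      unfolding p_def [abs_def]
    proof (intro has_bochner_integral_diff has_bochner_integral_mult_right)
      show "has_bochner_integral circle dirichlet2 A" using has_integral_torus_fun [OF Df] D0 by simp
      show "has_bochner_integral circle (\<lambda>y. A) A"
        using has_integral_torus_fun [OF torus_cont_fun [OF torus_cont_const [of A]]] by simp
      show "has_bochner_integral circle (?C 1) 0"
        by (rule has_integral_torus_funI [OF Cf [of 1 0]]) (use integral_cos [of 1 0] in \<open>simp\<close>)
    qed
    then show ?thesis by (simp add: has_bochner_integral_integral_eq)
  qed
  have pcos: "(\<integral>s. p s * cos (2 * pi * (real 1 * s + t)) \<partial>circle) = 0" for t
  proof -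
    have "has_bochner_integral circle (\<lambda>s. dirichlet2 s * cos (2 * pi * (real 1 * s + t)) - A * cos (2 * pi * (real 1 * s + t))
        - 2 / 3 * A * (?C 1 s * cos (2 * pi * (real 1 * s + t)))) (A / 3 * cos (2 * pi * t) - A * 0 - 2 / 3 * A * (cos (2 * pi * (0 - t)) / 2))"
    proof (intro has_bochner_integral_diff has_bochner_integral_mult_right)
      show "has_bochner_integral circle (\<lambda>s. dirichlet2 s * cos (2 * pi * (real 1 * s + t))) (A / 3 * cos (2 * pi * t))"
        using has_integral_torus_fun [OF torus_fun_mult [OF Df Cf [of 1 t]]] unfolding D1 .
      show "has_bochner_integral circle (\<lambda>s. cos (2 * pi * (real 1 * s + t))) 0"
        by (rule has_integral_torus_funI [OF Cf [of 1 t]]) (use integral_cos [of 1 t] in \<open>simp\<close>)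
      show "has_bochner_integral circle (\<lambda>s. ?C 1 s * cos (2 * pi * (real 1 * s + t))) (cos (2 * pi * (0 - t)) / 2)"
        by (rule has_integral_torus_funI [OF torus_fun_mult [OF Cf [of 1 0] Cf [of 1 t]]]) (use integral_cos_cos [of 1 0 t] in \<open>simp\<close>)
    qed
    moreover have "dirichlet2 s * cos (2 * pi * (real 1 * s + t)) - A * cos (2 * pi * (real 1 * s + t))
        - 2 / 3 * A * (?C 1 s * cos (2 * pi * (real 1 * s + t))) = p s * cos (2 * pi * (real 1 * s + t))" for s
      by (simp add: p_def algebra_simps)
    ultimately show ?thesis by (simp add: has_bochner_integral_integral_eq)
  qed
  have pshift: "(\<integral>s. p (s + y) * cos (2 * pi * (real 1 * s + t)) \<partial>circle) = 0" for y t
  proof -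
    have "torus_fun (\<lambda>s. p s * cos (2 * pi * (real 1 * s + (t - y))))" by (intro torus_fun_mult pf Cf)
    from integral_circle_shift [OF this, of y]
    show ?thesis using pcos [of "t - y"] by simp
  qed
  have psf: "torus_fun (\<lambda>s. p (2 * s + y))" for y using torus_fun_compose_affine [OF pf, of 2 y] by simp
  have P0: "(\<integral>s. p (2 * s + y) \<partial>circle) = 0" for y
    using integral_circle_dilate [OF torus_fun_compose_affine [OF pf, of 1 y], of 2] integral_circle_shift [OF pf, of y] p0
    by simp
  have P2: "(\<integral>s. p (2 * s + y) * ?C 2 s \<partial>circle) = 0" for y
  proof -
    have "torus_fun (\<lambda>s. p (s + y) * cos (2 * pi * (real 1 * s + 0)))"
      using torus_fun_mult [OF torus_fun_compose_affine [OF pf, of 1 y] Cf [of 1 0]] by simp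
    from integral_circle_dilate [OF this, of 2] show ?thesis using pshift [of y 0] by simp
  qed
  \<comment> \<open>The first factor has period \<open>1/2\<close> and the cosine changes sign under a shift by \<open>1/2\<close>.\<close>
  have P1: "(\<integral>s. p (2 * s + y) * ?C 1 s \<partial>circle) = 0" for y
  proof -
    let ?f = "\<lambda>s. p (2 * s + y) * ?C 1 s"
    have "torus_fun ?f" by (intro torus_fun_mult psf Cf)
    from integral_circle_shift [OF this, of "1/2"]
    have "(\<integral>s. ?f (s + 1/2) \<partial>circle) = integral\<^sup>L circle ?f" .
    moreover have "?f (s + 1/2) = - ?f s" for s
    proof -
      have "p (2 * (s + 1/2) + y) = p (2 * s + y)"
        using pc periodicD [of p "2 * s + y"] by (simp add: torus_cont_def algebra_simps)
      moreover have "2 * pi * (real 1 * (s + 1/2) + 0) = 2 * pi * (real 1 * s + 0) + pi" by (simp add: algebra_simps)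
      ultimately show ?thesis by (simp only: cos_periodic_pi)
    qed
    ultimately show ?thesis by simp
  qed
  define v where "v x = (\<integral>s. q s * p (2 * s + x) \<partial>circle) / A\<^sup>2" for x
  have expand: "(\<integral>s. dirichlet2 s * dirichlet2 (2 * s + x) \<partial>circle) / A\<^sup>2 =
      1 + 2 * (-1/45) * cos (2 * pi * (real 1 * x)) + v x" for x
  proof -
    have "has_bochner_integral circle (\<lambda>s. A * dirichlet2 s + 2 / 3 * A * (dirichlet2 s * cos (2 * pi * (real 2 * s + x)))
        + q s * p (2 * s + x) + A * p (2 * s + x) + 2 / 3 * A * (p (2 * s + x) * ?C 1 s) - 2 / 15 * A * (p (2 * s + x) * ?C 2 s))
       (A * A + 2 / 3 * A * (- A / 15 * cos (2 * pi * x)) + v x * A\<^sup>2 + A * 0 + 2 / 3 * A * 0 - 2 / 15 * A * 0)"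
    proof (intro has_bochner_integral_add has_bochner_integral_diff has_bochner_integral_mult_right)
      show "has_bochner_integral circle dirichlet2 A" using has_integral_torus_fun [OF Df] D0 by simp
      show "has_bochner_integral circle (\<lambda>s. dirichlet2 s * cos (2 * pi * (real 2 * s + x))) (- A / 15 * cos (2 * pi * x))"
        using has_integral_torus_fun [OF torus_fun_mult [OF Df Cf [of 2 x]]] unfolding D2 .
      show "has_bochner_integral circle (\<lambda>s. q s * p (2 * s + x)) (v x * A\<^sup>2)"
        using has_integral_torus_fun [OF torus_fun_mult [OF qf psf]] A0 by (simp add: v_def)
      show "has_bochner_integral circle (\<lambda>s. p (2 * s + x)) 0"
        using has_integral_torus_fun [OF psf] P0 by metis
      show "has_bochner_integral circle (\<lambda>s. p (2 * s + x) * ?C 1 s) 0"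
        using has_integral_torus_fun [OF torus_fun_mult [OF psf Cf [of 1 0]]] P1 by metis
      show "has_bochner_integral circle (\<lambda>s. p (2 * s + x) * ?C 2 s) 0"
        using has_integral_torus_fun [OF torus_fun_mult [OF psf Cf [of 2 0]]] P2 by metis
    qed
    moreover have "A * dirichlet2 s + 2 / 3 * A * (dirichlet2 s * cos (2 * pi * (real 2 * s + x)))
        + q s * p (2 * s + x) + A * p (2 * s + x) + 2 / 3 * A * (p (2 * s + x) * ?C 1 s) - 2 / 15 * A * (p (2 * s + x) * ?C 2 s)
        = dirichlet2 s * dirichlet2 (2 * s + x)" for s
    proof -
      have d: "dirichlet2 (2 * s + x) = p (2 * s + x) + A + 2 / 3 * A * cos (2 * pi * (real 2 * s + x))"
        by (simp add: p_def)
      have d': "dirichlet2 s = q s + A + 2 / 3 * A * ?C 1 s - 2 / 15 * A * ?C 2 s"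
        by (simp add: q_def)
      show ?thesis unfolding d by (simp add: d' algebra_simps)
    qed
    ultimately have "(\<integral>s. dirichlet2 s * dirichlet2 (2 * s + x) \<partial>circle) =
        A * A + 2 / 3 * A * (- A / 15 * cos (2 * pi * x)) + v x * A\<^sup>2"
      by (simp add: has_bochner_integral_integral_eq)
    then show ?thesis using A0 by (simp add: power2_eq_square field_simps)
  qed
  have vc: "torus_cont v"
    using torus_cont_mult [OF torus_cont_const [of "1 / A\<^sup>2"] torus_cont_integral_param [OF qf pc, of 2 1]]
    by (simp add: v_def [abs_def])
  have vcos: "(\<integral>x. v x * g x \<partial>circle) = 0" if g: "torus_fun g" and 0: "\<And>y. (\<integral>x. p (x + y) * g x \<partial>circle) = 0" for g
  proof -
    have "(\<integral>x. g x * (\<integral>s. q s * p (2 * s + x) \<partial>circle) \<partial>circle) = 0"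
      unfolding correlation_swap [OF qf pf g] using 0 by (simp add: mult.commute [of "g _"])
    then show ?thesis by (simp add: v_def mult.commute)
  qed
  have v0: "integral\<^sup>L circle v = 0"
    using vcos [OF torus_cont_fun [OF torus_cont_const [of 1]]] integral_circle_shift [OF pf] p0 by simp
  have vC: "(\<integral>x. v x * cos (2 * pi * (real 1 * x + t)) \<partial>circle) = 0" for t
    by (rule vcos [OF Cf pshift])
  have pp: "(\<integral>s. (p s)\<^sup>2 \<partial>circle) = 2 - 11 / 9 * A\<^sup>2"
  proof -
    have "has_bochner_integral circle (\<lambda>s. (dirichlet2 s)\<^sup>2 - 2 * A * dirichlet2 s - 4 / 3 * A * (dirichlet2 s * ?C 1 s)
        + A\<^sup>2 + 4 / 3 * A\<^sup>2 * ?C 1 s + 4 / 9 * A\<^sup>2 * (?C 1 s * ?C 1 s))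
       (2 - 2 * A * A - 4 / 3 * A * (A / 3) + A\<^sup>2 + 4 / 3 * A\<^sup>2 * 0 + 4 / 9 * A\<^sup>2 * (1 / 2))"
    proof (intro has_bochner_integral_add has_bochner_integral_diff has_bochner_integral_mult_right)
      show "has_bochner_integral circle (\<lambda>s. (dirichlet2 s)\<^sup>2) 2"
        by (rule has_integral_torus_funI [OF torus_fun_mult [OF Df Df], folded power2_eq_square, OF DD])
      show "has_bochner_integral circle dirichlet2 A" using has_integral_torus_fun [OF Df] D0 by simp
      show "has_bochner_integral circle (\<lambda>s. dirichlet2 s * ?C 1 s) (A / 3)"
        by (rule has_integral_torus_funI [OF torus_fun_mult [OF Df Cf [of 1 0]]]) (use D1 [of 0] in \<open>simp\<close>)
      show "has_bochner_integral circle (\<lambda>y. A\<^sup>2) (A\<^sup>2)"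
        using has_integral_torus_fun [OF torus_cont_fun [OF torus_cont_const [of "A\<^sup>2"]]] by simp
      show "has_bochner_integral circle (?C 1) 0"
        by (rule has_integral_torus_funI [OF Cf [of 1 0]]) (use integral_cos [of 1 0] in \<open>simp\<close>)
      show "has_bochner_integral circle (\<lambda>s. ?C 1 s * ?C 1 s) (1 / 2)"
        by (rule has_integral_torus_funI [OF torus_fun_mult [OF Cf [of 1 0] Cf [of 1 0]]]) (use integral_cos_cos [of 1 0 0] in \<open>simp\<close>)
    qed
    moreover have "(dirichlet2 s)\<^sup>2 - 2 * A * dirichlet2 s - 4 / 3 * A * (dirichlet2 s * ?C 1 s)
        + A\<^sup>2 + 4 / 3 * A\<^sup>2 * ?C 1 s + 4 / 9 * A\<^sup>2 * (?C 1 s * ?C 1 s) = (p s)\<^sup>2" for s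
      by (simp add: p_def power2_eq_square algebra_simps)
    ultimately have "(\<integral>s. (p s)\<^sup>2 \<partial>circle) = 2 - 2 * A * A - 4 / 3 * A * (A / 3) + A\<^sup>2 + 4 / 3 * A\<^sup>2 * 0 + 4 / 9 * A\<^sup>2 * (1 / 2)"
      by (simp only: has_bochner_integral_integral_eq)
    then show ?thesis by (simp add: power2_eq_square)
  qed
  have qq: "(\<integral>s. (q s)\<^sup>2 \<partial>circle) = 2 - 277 / 225 * A\<^sup>2"
  proof -
    have C12: "(\<integral>s. ?C 1 s * ?C 2 s \<partial>circle) = 0"
    proof -
      have e: "?C 1 s * ?C 2 s = cos (2 * pi * (real 1 * s + 0)) / 2 + cos (2 * pi * (real 3 * s + 0)) / 2" for s
        using cos_add [of "2 * pi * (2 * s)" "2 * pi * s"] cos_diff [of "2 * pi * (2 * s)" "2 * pi * s"]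
        by (simp add: algebra_simps)
      show ?thesis unfolding e
        using integral_cos [of 1 0] integral_cos [of 3 0] torus_fun_integrable [OF Cf [of 1 0]] torus_fun_integrable [OF Cf [of 3 0]]
        by (subst Bochner_Integration.integral_add) auto
    qed
    have "has_bochner_integral circle (\<lambda>s. (p s)\<^sup>2 + 4 / 15 * A * (dirichlet2 s * ?C 2 s) - 4 / 15 * A\<^sup>2 * ?C 2 s
        - 8 / 45 * A\<^sup>2 * (?C 1 s * ?C 2 s) + 4 / 225 * A\<^sup>2 * (?C 2 s * ?C 2 s))
       (2 - 11 / 9 * A\<^sup>2 + 4 / 15 * A * (- A / 15) - 4 / 15 * A\<^sup>2 * 0 - 8 / 45 * A\<^sup>2 * 0 + 4 / 225 * A\<^sup>2 * (1 / 2))"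
    proof (intro has_bochner_integral_add has_bochner_integral_diff has_bochner_integral_mult_right)
      show "has_bochner_integral circle (\<lambda>s. (p s)\<^sup>2) (2 - 11 / 9 * A\<^sup>2)"
        by (rule has_integral_torus_funI [OF torus_fun_mult [OF pf pf], folded power2_eq_square, OF pp])
      show "has_bochner_integral circle (\<lambda>s. dirichlet2 s * ?C 2 s) (- A / 15)"
        by (rule has_integral_torus_funI [OF torus_fun_mult [OF Df Cf [of 2 0]]]) (use D2 [of 0] in \<open>simp\<close>)
      show "has_bochner_integral circle (?C 2) 0"
        by (rule has_integral_torus_funI [OF Cf [of 2 0]]) (use integral_cos [of 2 0] in \<open>simp\<close>)
      show "has_bochner_integral circle (\<lambda>s. ?C 1 s * ?C 2 s) 0"
        using has_integral_torus_fun [OF torus_fun_mult [OF Cf [of 1 0] Cf [of 2 0]]] C12 by metis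
      show "has_bochner_integral circle (\<lambda>s. ?C 2 s * ?C 2 s) (1 / 2)"
        by (rule has_integral_torus_funI [OF torus_fun_mult [OF Cf [of 2 0] Cf [of 2 0]]]) (use integral_cos_cos [of 2 0 0] in \<open>simp\<close>)
    qed
    moreover have "(p s)\<^sup>2 + 4 / 15 * A * (dirichlet2 s * ?C 2 s) - 4 / 15 * A\<^sup>2 * ?C 2 s
        - 8 / 45 * A\<^sup>2 * (?C 1 s * ?C 2 s) + 4 / 225 * A\<^sup>2 * (?C 2 s * ?C 2 s) = (q s)\<^sup>2" for s
      by (simp add: p_def q_def power2_eq_square algebra_simps)
    ultimately have "(\<integral>s. (q s)\<^sup>2 \<partial>circle) = 2 - 11 / 9 * A\<^sup>2 + 4 / 15 * A * (- A / 15) - 4 / 15 * A\<^sup>2 * 0 - 8 / 45 * A\<^sup>2 * 0 + 4 / 225 * A\<^sup>2 * (1 / 2)"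
      by (simp only: has_bochner_integral_integral_eq)
    then show ?thesis by (simp add: power2_eq_square)
  qed
  have vb: "\<bar>v x\<bar> \<le> 1 / 90" for x
  proof -
    have pp2: "(\<integral>s. (p (2 * s + x))\<^sup>2 \<partial>circle) = 2 - 11 / 9 * A\<^sup>2"
    proof -
      have t: "torus_fun (\<lambda>s. (p s)\<^sup>2)" using torus_fun_mult [OF pf pf] by (simp add: power2_eq_square)
      show ?thesis
        using integral_circle_dilate [OF torus_fun_compose_affine [OF t, of 1 x], of 2] integral_circle_shift [OF t, of x] pp
        by simp
    qed
    have t1: "torus_fun (\<lambda>s. (q s)\<^sup>2)" using torus_fun_mult [OF qf qf] by (simp add: power2_eq_square)
    have t2: "torus_fun (\<lambda>s. (p (2 * s + x))\<^sup>2)" using torus_fun_mult [OF psf psf] by (simp add: power2_eq_square)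
    have "\<bar>\<integral>s. q s * p (2 * s + x) \<partial>circle\<bar> \<le> (\<integral>s. \<bar>q s * p (2 * s + x)\<bar> \<partial>circle)"
      by (rule integral_abs_bound)
    also have "\<dots> \<le> (\<integral>s. (q s)\<^sup>2 + (p (2 * s + x))\<^sup>2 / 4 \<partial>circle)"
    proof (rule integral_circle_mono)
      show "integrable circle (\<lambda>s. \<bar>q s * p (2 * s + x)\<bar>)"
        by (intro integrable_abs torus_fun_integrable torus_fun_mult qf psf)
      show "integrable circle (\<lambda>s. (q s)\<^sup>2 + (p (2 * s + x))\<^sup>2 / 4)"
        using torus_fun_integrable [OF t1] torus_fun_integrable [OF t2] by auto
      fix s
      \<comment> \<open>The weights balance the two norms: the \<open>L\<^sup>2\<close> norm of \<open>p\<close> is about twice that of \<open>q\<close>.\<close>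
      have "0 \<le> (\<bar>q s\<bar> - \<bar>p (2 * s + x)\<bar> / 2)\<^sup>2" by simp
      also have "\<dots> = (q s)\<^sup>2 + (p (2 * s + x))\<^sup>2 / 4 - \<bar>q s * p (2 * s + x)\<bar>"
        by (simp add: power2_diff abs_mult power_divide)
      finally show "\<bar>q s * p (2 * s + x)\<bar> \<le> (q s)\<^sup>2 + (p (2 * s + x))\<^sup>2 / 4" by simp
    qed
    also have "\<dots> = (2 - 277 / 225 * A\<^sup>2) + (2 - 11 / 9 * A\<^sup>2) / 4"
      using torus_fun_integrable [OF t1] torus_fun_integrable [OF t2] pp2 qq
      by (subst Bochner_Integration.integral_add) auto
    also have "\<dots> \<le> A\<^sup>2 / 90"
    proof -
      have "pi * pi \<le> 3.1416 * 3.1416" using pi_approx by (intro mult_mono) auto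
      then have le: "5 / 2 * (pi * pi) \<le> (1 / 90 + 277 / 225 + 11 / 36) * 16" by simp
      have "A\<^sup>2 * (pi * pi) = 16" by (simp add: A_def power2_eq_square)
      then have "(1 / 90 + 277 / 225 + 11 / 36) * A\<^sup>2 * (pi * pi) = (1 / 90 + 277 / 225 + 11 / 36) * 16"
        by (simp only: mult.assoc)
      then have "5 / 2 * (pi * pi) \<le> (1 / 90 + 277 / 225 + 11 / 36) * A\<^sup>2 * (pi * pi)"
        using le by (simp only:)
      then have "5 / 2 \<le> (1 / 90 + 277 / 225 + 11 / 36) * A\<^sup>2"
        by (rule mult_right_le_imp_le) simp
      then have "2250 \<le> 1393 * A\<^sup>2" by simp
      then show ?thesis by (simp add: field_simps)
    qed
    finally have "\<bar>\<integral>s. q s * p (2 * s + x) \<partial>circle\<bar> \<le> A\<^sup>2 / 90" .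
    then show ?thesis using A0 by (simp add: v_def abs_divide field_simps)
  qed
  show ?thesis
    using A0 vc vb v0 vC expand unfolding wave_def
    by (intro exI [of _ "A\<^sup>2"] conjI exI [of _ v]) auto
qed

section \<open>Exponentials of even functions\<close>

text \<open>
  The sign of \<open>(-1/45)^n\<close> depends on the parity of \<open>n\<close>, which is how both signs of the cosine become
  available; the remainder decays faster than the coefficient.
\<close>

lemma wave_iterate:
  assumes m: "m > 0"
  shows "\<exists>K. attainable K \<and> wave m ((-1/45) ^ Suc n) ((1/90) ^ Suc n) K"
proof -
  obtain A where A: "A > 0" and w: "wave 1 (-1/45) (1/90) (\<lambda>x. (\<integral>s. dirichlet2 s * dirichlet2 (2 * s + x) \<partial>circle) / A)"
    using wave_base by blast
  define K0 where "K0 = (\<lambda>x. (\<integral>s. dirichlet2 s * dirichlet2 (2 * s + real m * x) \<partial>circle) / A)"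
  have a0: "attainable K0"
    using attainable_scale [OF attainable_base [OF m], of "1 / A"] A by (simp add: K0_def)
  have w0: "wave m (-1/45) (1/90) K0"
    unfolding K0_def by (rule wave_dilate [OF w m])
  show ?thesis
  proof (induction n)
    case 0 then show ?case using a0 w0 by auto
  next
    case (Suc n)
    then obtain K where K: "attainable K" "wave m ((-1/45) ^ Suc n) ((1/90) ^ Suc n) K" by blast
    have "wave m ((-1/45) * (-1/45) ^ Suc n) ((1/90) * (1/90) ^ Suc n) (\<lambda>x. \<integral>s. K0 s * K (s + x) \<partial>circle)"
      by (rule wave_correlation [OF m w0 K(2)])
    then show ?case
      using attainable_correlation [OF a0 K(1)] unfolding power_Suc [of _ "Suc n"] by blast
  qed
qed

lemma exp_close:
  fixes a b :: real
  assumes "\<bar>a - b\<bar> \<le> d" "d \<le> 1/2"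
  shows "\<bar>exp a - exp b\<bar> \<le> exp b * (2 * d)"
proof -
  have "exp (a - b) \<le> 1 + 2 * d"
  proof -
    have "exp (a - b) \<le> exp d" using assms by simp
    also have "\<dots> \<le> 1 + 2 * d" using exp_bound_lemma [of d] assms by simp
    finally show ?thesis .
  qed
  moreover have "exp (a - b) \<ge> 1 - 2 * d" using exp_ge_add_one_self [of "a - b"] assms by linarith
  ultimately have "\<bar>exp (a - b) - 1\<bar> \<le> 2 * d" by linarith
  then have "exp b * \<bar>exp (a - b) - 1\<bar> \<le> exp b * (2 * d)" by (intro mult_left_mono) auto
  moreover have "exp b * \<bar>exp (a - b) - 1\<bar> = \<bar>exp a - exp b\<bar>"
  proof -
    have "exp b * \<bar>exp (a - b) - 1\<bar> = \<bar>exp b * (exp (a - b) - 1)\<bar>" by (simp add: abs_mult)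
    also have "exp b * (exp (a - b) - 1) = exp a - exp b" by (simp add: right_diff_distrib exp_add [symmetric])
    finally show ?thesis .
  qed
  ultimately show ?thesis by simp
qed

text \<open>
  With \<open>N\<close> about \<open>\<bar>t\<bar> / (2 d)\<close> the main term of \<open>N ln K\<close> is \<open>t cos (2 \<pi> m x)\<close>. The three
  errors come from rounding \<open>N\<close>, from the remainder of the wave, and from the quadratic term of
  the logarithm.
\<close>

lemma wave_power_close:
  assumes K: "wave m (sgn t * d) r K" and t: "t \<noteq> 0" and d: "0 < d" "d \<le> 1/45" and r: "0 \<le> r" "r \<le> d * q" "q \<le> 1"
  shows "\<exists>N. \<forall>x. K x > 0 \<and> \<bar>real N * ln (K x) - t * cos (2 * pi * (real m * x))\<bar> \<le> 2 * d + \<bar>t\<bar> * q / 2 + 9 * \<bar>t\<bar> * d"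
proof -
  \<comment> \<open>The exponent that turns the amplitude \<open>2 d\<close> into \<open>\<bar>t\<bar>\<close>, up to one unit of \<open>2 d\<close>.\<close>
  define N where "N = nat \<lfloor>\<bar>t\<bar> / (2 * d)\<rfloor>"
  have N1: "real N \<le> \<bar>t\<bar> / (2 * d)" using d by (simp add: N_def)
  have N2: "\<bar>t\<bar> / (2 * d) < real N + 1" using d by (simp add: N_def)
  have N3: "real N * (2 * d) \<le> \<bar>t\<bar>" "\<bar>t\<bar> \<le> real N * (2 * d) + 2 * d"
    using N1 N2 d by (simp_all add: field_simps)
  have "K x > 0 \<and> \<bar>real N * ln (K x) - t * cos (2 * pi * (real m * x))\<bar> \<le> 2 * d + \<bar>t\<bar> * q / 2 + 9 * \<bar>t\<bar> * d" for x
  proof -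
    let ?c = "cos (2 * pi * (real m * x))"
    obtain v where v: "\<bar>v\<bar> \<le> r" and Kx: "K x = 1 + 2 * (sgn t * d) * ?c + v"
      using K unfolding wave_def by blast
    define y where "y = 2 * (sgn t * d) * ?c + v"
    have Ky: "K x = 1 + y" by (simp add: y_def Kx)
    have c1: "\<bar>?c\<bar> \<le> 1" by simp
    have s1: "\<bar>sgn t\<bar> = 1" using t by (simp add: sgn_if)
    have rd: "r \<le> d" using r d mult_left_mono [of q 1 d] by linarith
    have "\<bar>2 * (sgn t * d) * ?c\<bar> \<le> 2 * d"
      using c1 s1 d by (simp add: abs_mult mult_left_le)
    then have y3: "\<bar>y\<bar> \<le> 3 * d" using v rd unfolding y_def by linarith
    have y12: "\<bar>y\<bar> \<le> 1/2" using y3 d by linarith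
    have pos: "K x > 0" using y12 unfolding Ky by linarith
    have a: "\<bar>real N * (2 * (sgn t * d) * ?c) - t * ?c\<bar> \<le> 2 * d"
    proof -
      have "real N * (2 * (sgn t * d) * ?c) - t * ?c = sgn t * ?c * (real N * (2 * d) - \<bar>t\<bar>)"
        using t by (cases "t > 0") (simp_all add: sgn_if algebra_simps)
      then have "\<bar>real N * (2 * (sgn t * d) * ?c) - t * ?c\<bar> = \<bar>?c\<bar> * \<bar>real N * (2 * d) - \<bar>t\<bar>\<bar>"
        using s1 by (simp add: abs_mult)
      also have "\<dots> \<le> 1 * (2 * d)" using c1 N3 by (intro mult_mono) auto
      finally show ?thesis by simp
    qed
    have b: "\<bar>real N * v\<bar> \<le> \<bar>t\<bar> * q / 2"
    proof -
      have "\<bar>real N * v\<bar> \<le> real N * (d * q)" using v r by (simp add: abs_mult mult_left_mono)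
      also have "\<dots> = (real N * (2 * d)) * q / 2" by simp
      also have "\<dots> \<le> \<bar>t\<bar> * q / 2"
      proof -
        have "q \<ge> 0" using r d by (smt (verit) zero_le_mult_iff)
        then show ?thesis using N3(1) by (intro divide_right_mono mult_right_mono) auto
      qed
      finally show ?thesis .
    qed
    have c: "\<bar>real N * (ln (1 + y) - y)\<bar> \<le> 9 * \<bar>t\<bar> * d"
    proof -
      have "\<bar>ln (1 + y) - y\<bar> \<le> 2 * y\<^sup>2" by (rule abs_ln_one_plus_x_minus_x_bound [OF y12])
      also have "y\<^sup>2 \<le> (3 * d)\<^sup>2" using y3 by (rule power2_le_iff_abs_le [THEN iffD2, rotated]) (use d in auto)
      finally have "\<bar>ln (1 + y) - y\<bar> \<le> (2 * d) * (9 * d)" by (simp add: power2_eq_square)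
      then have "\<bar>real N * (ln (1 + y) - y)\<bar> \<le> real N * ((2 * d) * (9 * d))" by (simp add: abs_mult mult_left_mono)
      also have "\<dots> = (real N * (2 * d)) * (9 * d)" by simp
      also have "\<dots> \<le> \<bar>t\<bar> * (9 * d)" using N3(1) d by (intro mult_right_mono) auto
      finally show ?thesis by simp
    qed
    have "real N * ln (K x) - t * ?c = (real N * (2 * (sgn t * d) * ?c) - t * ?c) + real N * v + real N * (ln (1 + y) - y)"
      unfolding Ky by (simp add: y_def algebra_simps)
    then show ?thesis using a b c pos by linarith
  qed
  then show ?thesis by blast
qed

lemma attainable_exp_cos:
  assumes m: "m > 0"
  shows "attainable (\<lambda>x. exp (t * cos (2 * pi * (real m * x))))"
proof (cases "t = 0")
  case True then show ?thesis using attainable_one by simp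
next
  case t: False
  show ?thesis
  proof (rule attainable_limit)
    show "torus_cont (\<lambda>x. exp (t * cos (2 * pi * (real m * x))))"
      using torus_cont_cos [of m 0] unfolding torus_cont_def periodic_def
      by (auto intro!: continuous_on_exp continuous_on_mult continuous_on_const)
    fix e :: real assume e: "e > 0"
    define E where "E = min (1/2) (e / (2 * exp \<bar>t\<bar>))"
    have E: "E > 0" "E \<le> 1/2" "exp \<bar>t\<bar> * (2 * E) \<le> e" using e by (auto simp: E_def min_def field_simps)
    obtain n0 where n0: "(1/2 :: real) ^ n0 < E / (2 + 10 * \<bar>t\<bar>)"
      using real_arch_pow_inv [of "E / (2 + 10 * \<bar>t\<bar>)" "1/2"] E by auto
    \<comment> \<open>The parity makes the sign of \<open>(-1/45) ^ (n + 1)\<close> that of \<open>t\<close>.\<close>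
    define n where "n = 2 * n0 + (if t > 0 then 1 else 0)"
    define d where "d = (1/45 :: real) ^ Suc n"
    have d: "d > 0" "d \<le> 1/45"
      unfolding d_def power_Suc by (auto simp: power_le_one)
    have sg: "(-1/45) ^ Suc n = sgn t * d"
    proof -
      have "(-1/45 :: real) ^ Suc n = (-1) ^ Suc n * d"
        unfolding d_def by (simp add: power_mult_distrib [symmetric])
      also have "(-1 :: real) ^ Suc n = sgn t" using t by (simp add: n_def)
      finally show ?thesis .
    qed
    obtain K where K: "attainable K" "wave m (sgn t * d) ((1/90) ^ Suc n) K"
      using wave_iterate [OF m, of n] unfolding sg by blast
    have rq: "(1/90 :: real) ^ Suc n = d * (1/2) ^ Suc n"
      unfolding d_def by (simp add: power_mult_distrib [symmetric])
    have q1: "(1/2 :: real) ^ Suc n \<le> 1" by (rule power_le_one) auto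
    obtain N where N: "\<And>x. K x > 0"
      "\<And>x. \<bar>real N * ln (K x) - t * cos (2 * pi * (real m * x))\<bar> \<le> 2 * d + \<bar>t\<bar> * (1/2) ^ Suc n / 2 + 9 * \<bar>t\<bar> * d"
      using wave_power_close [OF K(2) t d _ eq_refl [OF rq] q1] by auto
    have small: "2 * d + \<bar>t\<bar> * (1/2) ^ Suc n / 2 + 9 * \<bar>t\<bar> * d \<le> E"
    proof -
      have p: "(1/2 :: real) ^ Suc n \<le> (1/2) ^ n0" by (rule power_decreasing) (auto simp: n_def)
      have "d \<le> (1/2) ^ Suc n" unfolding d_def by (rule power_mono) auto
      then have dp: "d \<le> (1/2) ^ n0" using p by linarith
      have "\<bar>t\<bar> * (1/2) ^ Suc n \<le> \<bar>t\<bar> * (1/2) ^ n0" by (rule mult_left_mono [OF p abs_ge_zero])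
      moreover have "\<bar>t\<bar> * d \<le> \<bar>t\<bar> * (1/2) ^ n0" by (rule mult_left_mono [OF dp abs_ge_zero])
      moreover have "0 \<le> \<bar>t\<bar> * (1/2) ^ n0" by simp
      ultimately have "2 * d + \<bar>t\<bar> * (1/2) ^ Suc n / 2 + 9 * \<bar>t\<bar> * d \<le> 2 * (1/2) ^ n0 + 10 * (\<bar>t\<bar> * (1/2) ^ n0)"
        using dp by linarith
      also have "\<dots> = (1/2) ^ n0 * (2 + 10 * \<bar>t\<bar>)" by (simp add: algebra_simps)
      also have "\<dots> \<le> E" using n0 by (simp add: pos_less_divide_eq add_pos_nonneg)
      finally show ?thesis .
    qed
    show "\<exists>w. attainable w \<and> (\<forall>x. \<bar>w x - exp (t * cos (2 * pi * (real m * x)))\<bar> \<le> e)"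
    proof (intro exI [of _ "\<lambda>x. K x ^ N"] conjI allI attainable_power K)
      fix x
      let ?c = "cos (2 * pi * (real m * x))"
      have "K x ^ N = exp (real N * ln (K x))" using N(1) [of x] by (simp add: exp_of_nat_mult)
      moreover have "\<bar>exp (real N * ln (K x)) - exp (t * ?c)\<bar> \<le> exp (t * ?c) * (2 * E)"
        by (rule exp_close) (use N(2) [of x] small E in linarith)+
      moreover have "exp (t * ?c) * (2 * E) \<le> exp \<bar>t\<bar> * (2 * E)"
      proof -
        have "t * ?c \<le> \<bar>t * ?c\<bar>" by simp
        also have "\<dots> \<le> \<bar>t\<bar> * 1" unfolding abs_mult by (intro mult_left_mono) auto
        finally show ?thesis using E by (intro mult_right_mono) auto
      qed
      ultimately show "\<bar>K x ^ N - exp (t * ?c)\<bar> \<le> e" using E(3) by linarith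
    qed
  qed
qed

text \<open>
  Both signs of \<open>t\<close> are required, so that the exponents form a linear space.
\<close>

definition exponent :: "(real \<Rightarrow> real) \<Rightarrow> bool" where
  "exponent u \<longleftrightarrow> (\<forall>t. attainable (\<lambda>x. exp (t * u x)))"

lemma exponent_cos: "exponent (\<lambda>x. cos (2 * pi * (real m * x)))"
proof (cases "m = 0")
  case True
  have "attainable (\<lambda>x. exp t * 1)" for t by (rule attainable_scale [OF attainable_one]) simp
  then show ?thesis using True by (simp add: exponent_def)
next
  case False then show ?thesis using attainable_exp_cos by (simp add: exponent_def)
qed

lemma exponent_add: "exponent u \<Longrightarrow> exponent v \<Longrightarrow> exponent (\<lambda>x. u x + v x)"
  using attainable_mult by (simp add: exponent_def distrib_left exp_add)

lemma exponent_scale: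
  assumes "exponent u" shows "exponent (\<lambda>x. c * u x)"
proof -
  have "attainable (\<lambda>x. exp ((t * c) * u x))" for t using assms unfolding exponent_def by blast
  then show ?thesis unfolding exponent_def mult.assoc by blast
qed

lemma exponent_sum: "finite I \<Longrightarrow> (\<And>i. i \<in> I \<Longrightarrow> exponent (u i)) \<Longrightarrow> exponent (\<lambda>x. \<Sum>i\<in>I. u i x)"
proof (induction I rule: finite_induct)
  case empty
  show ?case using exponent_scale [OF exponent_cos, of 0 0] by simp
next
  case (insert i I)
  have "exponent (\<lambda>x. u i x + (\<Sum>i\<in>I. u i x))"
    by (intro exponent_add insert.IH insert.prems) auto
  then show ?case using insert.hyps by simp
qed

lemma exponent_limit:
  assumes u: "torus_cont u" and ap: "\<And>e. e > 0 \<Longrightarrow> \<exists>v. exponent v \<and> (\<forall>x. \<bar>v x - u x\<bar> \<le> e)"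
  shows "exponent u"
  unfolding exponent_def
proof
  fix t
  obtain B where B: "\<And>x. \<bar>u x\<bar> \<le> B" using torus_fun_bounded [OF torus_cont_fun [OF u]] by blast
  show "attainable (\<lambda>x. exp (t * u x))"
  proof (rule attainable_limit)
    show "torus_cont (\<lambda>x. exp (t * u x))"
      using u unfolding torus_cont_def periodic_def
      by (auto intro!: continuous_on_exp continuous_on_mult continuous_on_const)
    fix e :: real assume e: "e > 0"
    define M where "M = exp (\<bar>t\<bar> * B)"
    have M: "M > 0" by (simp add: M_def)
    define d where "d = min (1/2) (e / (2 * M))"
    have d: "d > 0" "d \<le> 1/2" "M * (2 * d) \<le> e" using e M by (auto simp: d_def min_def field_simps)
    obtain v where v: "exponent v" and vu: "\<And>x. \<bar>v x - u x\<bar> \<le> d / (\<bar>t\<bar> + 1)"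
      using ap [of "d / (\<bar>t\<bar> + 1)"] d by (auto simp: add_nonneg_pos)
    have "\<bar>exp (t * v x) - exp (t * u x)\<bar> \<le> e" for x
    proof -
      have "\<bar>t * v x - t * u x\<bar> = \<bar>t\<bar> * \<bar>v x - u x\<bar>" by (simp add: right_diff_distrib [symmetric] abs_mult)
      also have "\<dots> \<le> (\<bar>t\<bar> + 1) * (d / (\<bar>t\<bar> + 1))" using vu [of x] by (intro mult_mono) auto
      also have "\<dots> = d" by (simp add: add_nonneg_eq_0_iff)
      finally have "\<bar>exp (t * v x) - exp (t * u x)\<bar> \<le> exp (t * u x) * (2 * d)"
        using d by (intro exp_close)
      also have "\<dots> \<le> M * (2 * d)"
      proof -
        have "t * u x \<le> \<bar>t * u x\<bar>" by simp
        also have "\<dots> \<le> \<bar>t\<bar> * B" unfolding abs_mult using B by (intro mult_left_mono) auto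
        finally show ?thesis using d unfolding M_def by (intro mult_right_mono) auto
      qed
      also have "\<dots> \<le> e" by (rule d)
      finally show ?thesis .
    qed
    then show "\<exists>w. attainable w \<and> (\<forall>x. \<bar>w x - exp (t * u x)\<bar> \<le> e)"
      using v unfolding exponent_def by blast
  qed
qed

text \<open>
  The product formula for cosines reduces the power of the first factor; the second factor is there to
  make the induction go through.
\<close>

lemma exponent_cos_power:
  "exponent (\<lambda>x. cos (2 * pi * x) ^ n * cos (2 * pi * (real m * x)))"
proof (induction n arbitrary: m)
  case 0 then show ?case using exponent_cos by simp
next
  case (Suc n)
  show ?case
  proof (cases m)
    case 0
    then show ?thesis using Suc [of 1] by (simp add: mult.commute)
  next
    case (Suc k)
    have "cos (2 * pi * x) ^ Suc n * cos (2 * pi * (real m * x)) =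
        1/2 * (cos (2 * pi * x) ^ n * cos (2 * pi * (real (Suc m) * x))) + 1/2 * (cos (2 * pi * x) ^ n * cos (2 * pi * (real k * x)))" for x
    proof -
      have "2 * pi * (real (Suc m) * x) = 2 * pi * (real m * x) + 2 * pi * x"
        and "2 * pi * (real k * x) = 2 * pi * (real m * x) - 2 * pi * x"
        using Suc by (simp_all add: algebra_simps)
      then show ?thesis by (simp only: cos_add cos_diff) (simp add: algebra_simps)
    qed
    then show ?thesis by (simp only: exponent_add exponent_scale Suc.IH)
  qed
qed

text \<open>
  Continuous even periodic functions are the continuous functions of \<open>cos (2 \<pi> x)\<close>, so polynomial
  approximation on \<open>[-1, 1]\<close> suffices.
\<close>

lemma exponent_even_continuous:
  fixes H :: "real \<Rightarrow> real"
  assumes H: "continuous_on {-1..1} H"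
  shows "exponent (\<lambda>x. H (cos (2 * pi * x)))"
proof (rule exponent_limit)
  have "periodic (\<lambda>x. H (cos (2 * pi * x)))"
    using torus_cont_cos [of 1 0] by (simp add: torus_cont_def periodic_def)
  moreover have "continuous_on UNIV (\<lambda>x. H (cos (2 * pi * x)))"
    by (rule continuous_on_compose2 [OF H]) (auto intro!: continuous_intros)
  ultimately show "torus_cont (\<lambda>x. H (cos (2 * pi * x)))" by (simp add: torus_cont_def)
  fix e :: real assume "e > 0"
  then obtain g where g: "real_polynomial_function g" and gH: "\<And>x. x \<in> {-1..1} \<Longrightarrow> \<bar>H x - g x\<bar> < e"
    using Stone_Weierstrass_real_polynomial_function [OF compact_Icc H] by blast
  obtain a n where ga: "g = (\<lambda>x. \<Sum>i\<le>n. a i * x ^ i)"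
    using g unfolding real_polynomial_function_iff_sum by blast
  have "exponent (\<lambda>x. \<Sum>i\<le>n. a i * (cos (2 * pi * x) ^ i * cos (2 * pi * (real 0 * x))))"
    by (intro exponent_sum exponent_scale exponent_cos_power) simp
  then have "exponent (\<lambda>x. g (cos (2 * pi * x)))" by (simp add: ga)
  moreover have "\<bar>g (cos (2 * pi * x)) - H (cos (2 * pi * x))\<bar> \<le> e" for x
    using gH [of "cos (2 * pi * x)"] by (simp add: abs_minus_commute less_imp_le)
  ultimately show "\<exists>v. exponent v \<and> (\<forall>x. \<bar>v x - H (cos (2 * pi * x))\<bar> \<le> e)" by blast
qed

section \<open>Concentration on symmetric sets\<close>

lemma torus_set_one_minus:
  assumes "torus_set E" "symmetric_set E"
  shows "1 - x \<in> E \<longleftrightarrow> x \<in> E"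
proof -
  have "- x \<in> E \<longleftrightarrow> x \<in> E"
    using assms(2) unfolding symmetric_set_def by (metis image_eqI imageE minus_minus)
  moreover have "- x + 1 \<in> E \<longleftrightarrow> - x \<in> E"
    using assms(1) unfolding torus_set_def by blast
  ultimately show ?thesis by simp
qed

text \<open>
  A Lebesgue measurable set differs from a Borel set by a null set; the Borel version of its indicator,
  extended periodically, is a legitimate test function.
\<close>

lemma torus_indicator:
  assumes E: "torus_set E"
  obtains g where "torus_fun g" "\<And>x. g x = 0 \<or> g x = 1" "AE x in circle. g x = indicator E x"
    "\<And>f. torus_cont f \<Longrightarrow> torus_integral E f = (\<integral>x. g x * f x \<partial>circle)"
proof -
  have EL: "E \<in> sets lebesgue" using E by (simp add: torus_set_def)
  then have "indicat_real E \<in> borel_measurable (completion lborel)" by simp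
  then obtain g' :: "real \<Rightarrow> real" where g' [measurable]: "g' \<in> borel_measurable borel" and ae: "AE x in lborel. indicator E x = g' x"
    using completion_ex_borel_measurable_real [of "indicat_real E" lborel] by auto
  define g where "g x = (if g' (frac x) = 1 then 1 else 0 :: real)" for x
  have fr: "frac (x + 1) = frac x" for x :: real
    using frac_1_eq by auto
  have gm [measurable]: "g \<in> borel_measurable borel"
  proof -
    have "(frac :: real \<Rightarrow> real) \<in> borel_measurable borel" unfolding frac_def [abs_def] by measurable
    then show ?thesis unfolding g_def [abs_def] by measurable
  qed
  have g01: "g x = 0 \<or> g x = 1" for x by (simp add: g_def)
  have "\<forall>x. \<bar>g x\<bar> \<le> 1" by (simp add: g_def)
  then have gt: "torus_fun g"
    unfolding torus_fun_def periodic_def using gm by (auto simp: g_def fr)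
  have gE: "AE x in lborel. x \<in> {0..<1} \<longrightarrow> g x = indicator E x"
    using ae
  proof eventually_elim
    case (elim x)
    show ?case
    proof
      assume "x \<in> {0..<1}"
      then have "frac x = x" by (simp add: frac_eq)
      then show "g x = indicator E x" using elim by (cases "x \<in> E") (simp_all add: g_def)
    qed
  qed
  have gAE: "AE x in circle. g x = indicator E x"
    using AE_circle_of_lborel [OF gE] AE_circle_mem by eventually_elim auto
  have int: "torus_integral E f = (\<integral>x. g x * f x \<partial>circle)" if f: "torus_cont f" for f
  proof -
    have [measurable]: "f \<in> borel_measurable borel" using torus_fun_measurable [OF torus_cont_fun [OF f]] .
    have fl: "f \<in> borel_measurable lebesgue" by (rule measurable_completion) simp
    have El: "E \<inter> {0..<1} \<in> sets lebesgue" using EL by auto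
    have ml: "(\<lambda>x. indicator {0..<1} x * (g x * f x)) \<in> borel_measurable lborel" by measurable
    have "torus_integral E f = (\<integral>x. indicator (E \<inter> {0..<1}) x * f x \<partial>lebesgue)"
      by (simp add: torus_integral_def set_lebesgue_integral_def)
    also have "\<dots> = (\<integral>x. indicator {0..<1} x * (g x * f x) \<partial>lebesgue)"
    proof (rule integral_cong_AE)
      show "(\<lambda>x. indicator (E \<inter> {0..<1}) x * f x) \<in> borel_measurable lebesgue"
        using El fl by (intro borel_measurable_times borel_measurable_indicator)
      show "(\<lambda>x. indicator {0..<1} x * (g x * f x)) \<in> borel_measurable lebesgue"
        using ml by (rule measurable_completion)
      have "AE x in lebesgue. x \<in> {0..<1} \<longrightarrow> g x = indicator E x"
        using gE by (rule AE_completion)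
      then show "AE x in lebesgue. indicator (E \<inter> {0..<1}) x * f x = indicator {0..<1} x * (g x * f x)"
        by eventually_elim (auto simp: indicator_def)
    qed
    also have "\<dots> = (\<integral>x. indicator {0..<1} x * (g x * f x) \<partial>lborel)"
      by (rule integral_completion [OF ml])
    also have "\<dots> = (\<integral>x. g x * f x \<partial>circle)"
      by (rule integral_circle [symmetric]) simp
    finally show ?thesis .
  qed
  show ?thesis by (rule that [OF gt g01 gAE int])
qed

lemma torus_set_UNIV: "torus_set UNIV" "symmetric_set UNIV" "torus_measure UNIV > 0"
proof -
  show "torus_set UNIV" by (simp add: torus_set_def)
  show "symmetric_set UNIV" by (simp add: symmetric_set_def)
  show "torus_measure UNIV > 0" by (simp add: torus_measure_def)
qed

lemma torus_integral_UNIV: 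
  assumes f: "torus_cont f" shows "torus_integral UNIV f = integral\<^sup>L circle f"
proof -
  obtain g where g: "torus_fun g" "\<And>x. g x = 0 \<or> g x = 1" and ae: "AE x in circle. g x = indicator UNIV x"
    and i: "\<And>f. torus_cont f \<Longrightarrow> torus_integral UNIV f = (\<integral>x. g x * f x \<partial>circle)"
    using torus_indicator [OF torus_set_UNIV(1)] by blast
  have "(\<integral>x. g x * f x \<partial>circle) = integral\<^sup>L circle f"
  proof (rule integral_cong_AE)
    show "AE x in circle. g x * f x = f x" using ae by eventually_elim simp
  qed (use torus_fun_measurable [OF torus_fun_mult [OF g(1) torus_cont_fun [OF f]]]
         torus_fun_measurable [OF torus_cont_fun [OF f]] in simp_all)
  then show ?thesis using i [OF f] by simp
qed

lemma torus_measure_pos_integral: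
  assumes E: "torus_set E" "torus_measure E > 0"
  shows "torus_integral E (\<lambda>x. 1) > 0"
proof -
  have EL: "E \<inter> {0..<1} \<in> sets lebesgue" using E by (auto simp: torus_set_def)
  have fin: "emeasure lebesgue (E \<inter> {0..<1}) < \<infinity>"
  proof -
    have "emeasure lebesgue (E \<inter> {0..<1}) \<le> emeasure lebesgue {0..<1::real}"
      by (intro emeasure_mono) auto
    also have "\<dots> < \<infinity>" by simp
    finally show ?thesis .
  qed
  have "torus_integral E (\<lambda>x. 1) = measure lebesgue (E \<inter> {0..<1})"
    unfolding torus_integral_def set_lebesgue_integral_def using EL fin by simp
  also have "\<dots> > 0"
    using E(2) fin unfolding torus_measure_def measure_def by (simp add: enn2real_positive_iff)
  finally show ?thesis .
qed

lemma AE_circle_reflect: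
  assumes "AE x in lborel. P x"
  shows "AE x in circle. P x \<and> P (1 - x)"
proof -
  obtain N where N: "N \<in> null_sets lborel" "{x. \<not> P x} \<subseteq> N"
    using assms by (auto simp: eventually_ae_filter)
  have Nb [measurable]: "N \<in> sets borel" using N by auto
  have n: "AE x in lborel. x \<notin> N" using N by (intro AE_not_in)
  have "AE x in lborel. 1 + (-1) * x \<notin> N"
    by (rule AE_borel_affine [OF _ _ n]) auto
  then have "AE x in lborel. P (1 - x)" by eventually_elim (use N in auto)
  then show ?thesis using assms AE_circle_of_lborel by (intro AE_circle_of_lborel) auto
qed

text \<open>
  The map \<open>x \<mapsto> arccos (cos (2 \<pi> x)) / (2 \<pi>)\<close> folds the circle onto \<open>[0, 1/2]\<close>. Composing continuous
  approximants of the indicator with it makes them even and periodic, and the symmetry of \<open>E\<close>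
  ensures that the limit is unchanged.
\<close>

lemma even_continuous_approx:
  assumes E: "torus_set E" "symmetric_set E"
  obtains H :: "nat \<Rightarrow> real \<Rightarrow> real" where "\<And>n. continuous_on {-1..1} (H n)" "\<And>n c. c \<in> {-1..1} \<Longrightarrow> 0 \<le> H n c \<and> H n c \<le> 1"
    "AE x in circle. (\<lambda>n. H n (cos (2 * pi * x))) \<longlonglongrightarrow> indicator E x"
proof -
  have "E \<in> sets lebesgue" using E by (simp add: torus_set_def)
  then have "indicat_real E \<in> borel_measurable lebesgue" by simp
  moreover have "\<bar>indicat_real E x\<bar> \<le> 1" for x by (simp add: indicator_def)
  ultimately obtain h :: "nat \<Rightarrow> real \<Rightarrow> real" where h: "\<And>n. continuous_on UNIV (h n)" "\<And>n x. \<bar>h n x\<bar> \<le> 1"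
    and lim: "AE x in lborel. (\<lambda>n. h n x) \<longlonglongrightarrow> indicator E x"
    using approx_continuous_AE [of "indicat_real E" 1] by blast
  define H where "H n c = max 0 (h n (arccos c / (2 * pi)))" for n c
  have "continuous_on {-1..1} (H n)" for n
  proof -
    have "continuous_on {-1..1} (\<lambda>c. h n (arccos c / (2 * pi)))"
      by (rule continuous_on_compose2 [OF h(1)]) (auto intro!: continuous_intros)
    then show ?thesis unfolding H_def [abs_def] by (intro continuous_on_max continuous_on_const)
  qed
  moreover have "0 \<le> H n c \<and> H n c \<le> 1" for n c
    using h(2) [of n "arccos c / (2 * pi)"] by (auto simp: H_def)
  moreover have "AE x in circle. (\<lambda>n. H n (cos (2 * pi * x))) \<longlonglongrightarrow> indicator E x"
    using AE_circle_reflect [OF lim] AE_circle_mem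
  proof eventually_elim
    case (elim x)
    define y where "y = arccos (cos (2 * pi * x)) / (2 * pi)"
    have y: "y = x \<or> y = 1 - x"
    proof (cases "x \<le> 1/2")
      case True
      then have "2 * pi * x \<le> pi" using mult_left_mono [of x "1/2" "2 * pi"] by simp
      then have "arccos (cos (2 * pi * x)) = 2 * pi * x" using elim by (intro arccos_cos) auto
      then show ?thesis by (simp add: y_def)
    next
      case False
      have "cos (2 * pi * x) = cos (2 * pi * (1 - x))"
        using cos_periodic [of "- (2 * pi * x)"] by (simp add: algebra_simps)
      moreover have "2 * pi * (1 - x) \<le> pi" using False mult_left_mono [of "1 - x" "1/2" "2 * pi"] by simp
      then have "arccos (cos (2 * pi * (1 - x))) = 2 * pi * (1 - x)" using elim by (intro arccos_cos) auto
      ultimately show ?thesis by (simp add: y_def)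
    qed
    have "(\<lambda>n. h n y) \<longlonglongrightarrow> indicator E y" using y elim by auto
    moreover have "indicat_real E y = indicator E x"
      using y torus_set_one_minus [OF E, of x] by (auto simp: indicator_def)
    ultimately have "(\<lambda>n. max 0 (h n y)) \<longlonglongrightarrow> max 0 (indicator E x)" by (intro tendsto_max tendsto_const) simp
    then show ?case by (simp add: H_def y_def max_absorb2)
  qed
  ultimately show ?thesis using that by blast
qed

lemma attainable_weight:
  assumes H: "continuous_on {-1..1} H" and pos: "\<And>c. c \<in> {-1..1} \<Longrightarrow> H c > 0"
  shows "attainable (\<lambda>x. H (cos (2 * pi * x)))"
proof -
  have "continuous_on {-1..1} (\<lambda>c. ln (H c))"
    using pos by (intro continuous_on_ln H) force
  then have "exponent (\<lambda>x. ln (H (cos (2 * pi * x))))" by (rule exponent_even_continuous)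
  then have "attainable (\<lambda>x. exp (1 * ln (H (cos (2 * pi * x)))))" unfolding exponent_def by blast
  then show ?thesis using pos by simp
qed

text \<open>
  An even continuous function close to the indicator of \<open>E\<close> in \<open>L\<^sup>1\<close>, made positive by a small constant,
  is attainable. Testing against the indicator of \<open>E\<close> and against 1 transfers its concentration to an
  idempotent.
\<close>

lemma concentration_with_gaps:
  assumes E: "torus_set E" "symmetric_set E" "torus_measure E > 0" and c: "0 \<le> c" "c < 1"
  shows "\<exists>H. finite H \<and> H \<noteq> {} \<and> gaps_at_least N H \<and>
    torus_integral E (abs_idem H) \<ge> c * torus_integral UNIV (abs_idem H)"
proof -
  obtain g where g: "torus_fun g" "\<And>x. g x = 0 \<or> g x = 1" and gE: "AE x in circle. g x = indicator E x"
    and gint: "\<And>f. torus_cont f \<Longrightarrow> torus_integral E f = (\<integral>x. g x * f x \<partial>circle)"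
    using torus_indicator [OF E(1)] by blast
  have [measurable]: "g \<in> borel_measurable borel" by (rule torus_fun_measurable [OF g(1)])
  define \<gamma> where "\<gamma> = integral\<^sup>L circle g"
  have \<gamma>: "\<gamma> > 0"
    using torus_measure_pos_integral [OF E(1,3)] gint [OF torus_cont_const [of 1]] by (simp add: \<gamma>_def)
  \<comment> \<open>Five losses of size \<open>\<gamma> d\<close> occur below, two for \<open>E\<close> and three for the circle; a margin of 8 covers them.\<close>
  define d where "d = (1 - c) / 8"
  have d: "d > 0" "c = 1 - 8 * d" using c by (simp_all add: d_def field_simps)
  obtain H :: "nat \<Rightarrow> real \<Rightarrow> real" where Hc: "\<And>n. continuous_on {-1..1} (H n)" and H01: "\<And>n c. c \<in> {-1..1} \<Longrightarrow> 0 \<le> H n c \<and> H n c \<le> 1"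
    and Hlim: "AE x in circle. (\<lambda>n. H n (cos (2 * pi * x))) \<longlonglongrightarrow> indicator E x"
    using even_continuous_approx [OF E(1,2)] by blast
  define k where "k n x = H n (cos (2 * pi * x))" for n x
  have kc: "torus_cont (k n)" for n
  proof -
    have "continuous_on UNIV (k n)"
      unfolding k_def by (rule continuous_on_compose2 [OF Hc]) (auto intro!: continuous_intros)
    moreover have "periodic (k n)"
      using torus_cont_cos [of 1 0] by (simp add: torus_cont_def periodic_def k_def)
    ultimately show ?thesis by (simp add: torus_cont_def)
  qed
  have [measurable]: "k n \<in> borel_measurable borel" for n by (rule torus_fun_measurable [OF torus_cont_fun [OF kc]])
  have k01: "0 \<le> k n x" "k n x \<le> 1" for n x using H01 [of "cos (2 * pi * x)" n] by (auto simp: k_def)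
  have klim: "AE x in circle. (\<lambda>n. k n x) \<longlonglongrightarrow> g x"
    using Hlim gE by eventually_elim (simp add: k_def)
  have L1: "(\<lambda>n. integral\<^sup>L circle (k n)) \<longlonglongrightarrow> \<gamma>"
    unfolding \<gamma>_def
    by (rule integral_dominated_convergence [where w = "\<lambda>x. 1"]) (use klim k01 in auto)
  have L2: "(\<lambda>n. \<integral>x. g x * k n x \<partial>circle) \<longlonglongrightarrow> \<gamma>"
    unfolding \<gamma>_def
  proof (rule integral_dominated_convergence [where w = "\<lambda>x. 1"])
    show "AE x in circle. (\<lambda>n. g x * k n x) \<longlonglongrightarrow> g x"
      using klim
    proof eventually_elim
      case (elim x)
      have "(\<lambda>n. g x * k n x) \<longlonglongrightarrow> g x * g x" using elim by (rule tendsto_mult_left)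
      moreover have "g x * g x = g x" using g(2) [of x] by auto
      ultimately show ?case by simp
    qed
    show "AE x in circle. norm (g x * k n x) \<le> 1" for n
    proof (rule AE_I2)
      fix x show "norm (g x * k n x) \<le> 1" using g(2) [of x] k01 [of n x] by auto
    qed
  qed auto
  have "\<forall>\<^sub>F n in sequentially. integral\<^sup>L circle (k n) < \<gamma> * (1 + d) \<and> \<gamma> * (1 - d) < (\<integral>x. g x * k n x \<partial>circle)"
  proof (intro eventually_conj order_tendstoD [OF L1] order_tendstoD [OF L2])
    show "\<gamma> < \<gamma> * (1 + d)" "\<gamma> * (1 - d) < \<gamma>" using \<gamma> d by (simp_all add: algebra_simps)
  qed
  then obtain n where n: "integral\<^sup>L circle (k n) < \<gamma> * (1 + d)" "\<gamma> * (1 - d) < (\<integral>x. g x * k n x \<partial>circle)"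
    by (auto dest: eventually_happens)
  define w where "w x = k n x + \<gamma> * d" for x
  have gd: "\<gamma> * d > 0" using \<gamma> d by simp
  have wa: "attainable w"
  proof -
    have "attainable (\<lambda>x. H n (cos (2 * pi * x)) + \<gamma> * d)"
      by (rule attainable_weight [where H = "\<lambda>c. H n c + \<gamma> * d"])
        (use H01 gd in \<open>auto intro!: continuous_on_add continuous_on_const Hc add_nonneg_pos\<close>)
    then show ?thesis by (simp add: w_def [abs_def] k_def)
  qed
  have w1: "(\<integral>x. 1 * w x \<partial>circle) < \<gamma> * (1 + 2 * d)"
    using n(1) torus_fun_integrable [OF torus_cont_fun [OF kc [of n]]]
    by (simp add: w_def algebra_simps)
  have w2: "\<gamma> * (1 - d) < (\<integral>x. g x * w x \<partial>circle)"
  proof -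
    have "(\<integral>x. g x * k n x \<partial>circle) \<le> (\<integral>x. g x * w x \<partial>circle)"
    proof (rule integral_circle_mono)
      show "integrable circle (\<lambda>x. g x * k n x)"
        by (rule torus_fun_integrable [OF torus_fun_mult [OF g(1) torus_cont_fun [OF kc]]])
      show "integrable circle (\<lambda>x. g x * w x)"
        by (rule torus_fun_integrable [OF torus_fun_mult [OF g(1) torus_cont_fun [OF attainable_cont [OF wa]]]])
      show "g x * k n x \<le> g x * w x" for x using g(2) [of x] gd by (auto simp: w_def)
    qed
    then show ?thesis using n(2) by linarith
  qed
  have tests: "finite {g, \<lambda>x. 1}" "\<And>f. f \<in> {g, \<lambda>x. 1} \<Longrightarrow> torus_fun f"
    using g(1) torus_cont_fun [OF torus_cont_const [of 1]] by auto
  obtain F b where F: "finite F" "F \<noteq> {}" "spread N F" "b > 0"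
    and near: "\<And>f. f \<in> {g, \<lambda>x. 1} \<Longrightarrow> \<bar>b * (\<integral>x. f x * abs_idem F x \<partial>circle) - (\<integral>x. f x * w x \<partial>circle)\<bar> < \<gamma> * d"
    using attainableE [OF wa tests gd, where N = N] by blast
  have i1: "torus_integral UNIV (abs_idem F) = integral\<^sup>L circle (abs_idem F)"
    by (rule torus_integral_UNIV [OF torus_cont_abs_idem])
  have i2: "torus_integral E (abs_idem F) = (\<integral>x. g x * abs_idem F x \<partial>circle)"
    by (rule gint [OF torus_cont_abs_idem])
  have up: "b * torus_integral UNIV (abs_idem F) \<le> \<gamma> * (1 + 3 * d)"
    using near [of "\<lambda>x. 1"] w1 unfolding i1 by (simp add: algebra_simps)
  have lo: "\<gamma> * (1 - 2 * d) \<le> b * torus_integral E (abs_idem F)"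
    using near [of g] w2 unfolding i2 by (simp add: algebra_simps)
  have "b * (c * torus_integral UNIV (abs_idem F)) = c * (b * torus_integral UNIV (abs_idem F))" by simp
  also have "\<dots> \<le> c * (\<gamma> * (1 + 3 * d))" using up c(1) by (rule mult_left_mono)
  also have "\<dots> = \<gamma> * (c * (1 + 3 * d))" by simp
  also have "\<dots> \<le> \<gamma> * (1 - 2 * d)"
  proof -
    have "c * (1 + 3 * d) = 1 - 5 * d - 24 * d\<^sup>2" unfolding d(2) by (simp add: algebra_simps power2_eq_square)
    also have "\<dots> \<le> 1 - 2 * d" using d(1) zero_le_power2 [of d] by linarith
    finally show ?thesis using \<gamma> by (intro mult_left_mono) auto
  qed
  also have "\<dots> \<le> b * torus_integral E (abs_idem F)" by (rule lo)
  finally have "c * torus_integral UNIV (abs_idem F) \<le> torus_integral E (abs_idem F)"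
    using F(4) by simp
  then show ?thesis using F spread_gaps by blast
qed

lemma idempotent_at_0: "finite H \<Longrightarrow> idempotent_of H 0 = of_nat (card H)"
  by (simp add: idempotent_of_def)

lemma idempotent_nonzero: "finite H \<Longrightarrow> H \<noteq> {} \<Longrightarrow> idempotent_of H \<noteq> (\<lambda>t. 0)"
  using idempotent_at_0 [of H] by (auto dest: fun_cong [of _ _ 0])

lemma integral_abs_idem_pos:
  assumes "finite H" "H \<noteq> {}"
  shows "integral\<^sup>L circle (abs_idem H) > 0"
proof -
  let ?f = "abs_idem H"
  have fc: "torus_cont ?f" by (rule torus_cont_abs_idem)
  then have cont: "continuous_on UNIV ?f" by (simp add: torus_cont_def)
  have f0: "?f 0 \<ge> 1"
    using assms idempotent_at_0 [of H] card_gt_0_iff [of H] by (simp add: abs_idem_def)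
  obtain r where r: "r > 0" and near: "\<And>x. \<bar>x\<bar> < r \<Longrightarrow> \<bar>?f x - ?f 0\<bar> < 1/2"
    using cont [unfolded continuous_on_iff, THEN bspec, OF UNIV_I, THEN spec, THEN mp, OF half_gt_zero [OF zero_less_one], of 0]
    by (auto simp: dist_real_def)
  define s where "s = min r 1"
  have s: "s > 0" "s \<le> 1" "s \<le> r" using r by (auto simp: s_def)
  have "(\<integral>x. indicator {0..<s} x * (1/2 :: real) \<partial>circle) \<le> integral\<^sup>L circle ?f"
  proof (rule integral_circle_mono)
    show "integrable circle (\<lambda>x. indicator {0..<s} x * (1/2 :: real))"
      by (rule integrable_circle [where B = "1/2"]) (auto simp: indicator_def)
    show "integrable circle ?f" by (rule torus_fun_integrable [OF torus_cont_fun [OF fc]])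
    fix x :: real assume "x \<in> {0..<1}"
    show "indicator {0..<s} x * (1/2) \<le> ?f x"
    proof (cases "x \<in> {0..<s}")
      case True
      then have "\<bar>?f x - ?f 0\<bar> < 1/2" using s by (intro near) auto
      then have "1/2 \<le> ?f x" using f0 by linarith
      then show ?thesis using True by simp
    qed (simp add: abs_idem_nonneg)
  qed
  moreover have "(\<integral>x. indicator {0..<s} x * (1/2 :: real) \<partial>circle) = s / 2"
  proof -
    have "(\<integral>x. indicator {0..<s} x * (1/2 :: real) \<partial>circle) = (\<integral>x. indicator {0..<1} x * (indicator {0..<s} x * (1/2 :: real)) \<partial>lborel)"
      by (rule integral_circle) simp
    also have "\<dots> = (\<integral>x. indicator {0..<s} x * (1/2 :: real) \<partial>lborel)"
      using s by (intro Bochner_Integration.integral_cong) (auto simp: indicator_def)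
    also have "\<dots> = s / 2" using s by simp
    finally show ?thesis .
  qed
  ultimately show ?thesis using s by linarith
qed

lemma concentration_level_one_ge:
  assumes c: "0 \<le> c" "c < 1"
  shows "concentration_level 1 \<ge> c"
proof -
  let ?S = "{\<gamma>. \<gamma> \<ge> 0 \<and> (\<forall>E. torus_set E \<and> symmetric_set E \<and> torus_measure E > 0 \<longrightarrow>
      (\<exists>f\<in>idempotents. f \<noteq> (\<lambda>t. 0) \<and>
         torus_integral E (\<lambda>t. cmod (f t) powr 1) \<ge> \<gamma> * torus_integral UNIV (\<lambda>t. cmod (f t) powr 1)))}"
  have p1: "(\<lambda>t. cmod (idempotent_of H t) powr 1) = abs_idem H" for H
    by (simp add: abs_idem_def fun_eq_iff)
  have "c \<in> ?S"
  proof (intro CollectI conjI allI impI c(1))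
    fix E assume "torus_set E \<and> symmetric_set E \<and> torus_measure E > 0"
    then obtain H where "finite H" "H \<noteq> {}" "torus_integral E (abs_idem H) \<ge> c * torus_integral UNIV (abs_idem H)"
      using concentration_with_gaps [of E c 0] c by blast
    then show "\<exists>f\<in>idempotents. f \<noteq> (\<lambda>t. 0) \<and>
        torus_integral E (\<lambda>t. cmod (f t) powr 1) \<ge> c * torus_integral UNIV (\<lambda>t. cmod (f t) powr 1)"
      using idempotent_nonzero unfolding idempotents_def
      by (intro bexI [of _ "idempotent_of H"]) (auto simp only: p1)
  qed
  moreover have "bdd_above ?S"
  proof (rule bdd_aboveI [of _ 1])
    fix \<gamma> assume "\<gamma> \<in> ?S"
    have "\<exists>f\<in>idempotents. f \<noteq> (\<lambda>t. 0) \<and>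
        torus_integral UNIV (\<lambda>t. cmod (f t) powr 1) \<ge> \<gamma> * torus_integral UNIV (\<lambda>t. cmod (f t) powr 1)"
      by (rule CollectD [OF \<open>\<gamma> \<in> ?S\<close>, THEN conjunct2, THEN spec, THEN mp])
         (intro conjI torus_set_UNIV)
    then obtain f where fi: "f \<in> idempotents" and f0: "f \<noteq> (\<lambda>t. 0)"
      and f: "torus_integral UNIV (\<lambda>t. cmod (f t) powr 1) \<ge> \<gamma> * torus_integral UNIV (\<lambda>t. cmod (f t) powr 1)"
      by (elim bexE conjE)
    obtain H where H: "finite H" "f = idempotent_of H"
      using fi unfolding idempotents_def by blast
    have Hn: "H \<noteq> {}" using f0 H(2) by (auto simp: idempotent_of_def)
    have pos: "torus_integral UNIV (abs_idem H) > 0"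
      unfolding torus_integral_UNIV [OF torus_cont_abs_idem] by (rule integral_abs_idem_pos [OF H(1) Hn])
    have "\<gamma> * torus_integral UNIV (abs_idem H) \<le> 1 * torus_integral UNIV (abs_idem H)"
      using f unfolding H(2) p1 by simp
    then show "\<gamma> \<le> 1" using pos by (rule mult_right_le_imp_le)
  qed
  ultimately show ?thesis unfolding concentration_level_def by (rule cSup_upper)
qed

theorem theorem3:
  "concentration_level 1 > 0.96 \<and>
   (\<exists>c::real. c > 0.96 \<and>
     (\<forall>E N. torus_set E \<and> symmetric_set E \<and> torus_measure E > 0 \<longrightarrow>
       (\<exists>H. finite H \<and> gaps_at_least N H \<and> idempotent_of H \<noteq> (\<lambda>t. 0) \<and>
          torus_integral E (\<lambda>t. cmod (idempotent_of H t))
            \<ge> c * torus_integral UNIV (\<lambda>t. cmod (idempotent_of H t)))))"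
proof (intro conjI exI [of _ "0.97 :: real"] allI impI)
  show "concentration_level 1 > 0.96" using concentration_level_one_ge [of "0.97"] by simp
  show "(0.97 :: real) > 0.96" by simp
  fix E N assume "torus_set E \<and> symmetric_set E \<and> torus_measure E > 0"
  then obtain H where "finite H" "H \<noteq> {}" "gaps_at_least N H"
    "torus_integral E (abs_idem H) \<ge> 0.97 * torus_integral UNIV (abs_idem H)"
    using concentration_with_gaps [of E "0.97" N] by auto
  then show "\<exists>H. finite H \<and> gaps_at_least N H \<and> idempotent_of H \<noteq> (\<lambda>t. 0) \<and>
      torus_integral E (\<lambda>t. cmod (idempotent_of H t)) \<ge> 0.97 * torus_integral UNIV (\<lambda>t. cmod (idempotent_of H t))"
    using idempotent_nonzero unfolding abs_idem_def [abs_def] by blast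
qed

end
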